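(* Let $f_{xxx}$ be a ternary cubic form over $\mathbb{C}$. The following are equivalent: (1) $\theta^{\Delta}_{uuxx}=0$ and $\Delta_{xxx}\neq 0$. (2) $\Delta_{xxx}=a_x^3$ for some nonzero linear form $a_x$. (3) $f_{xxx}=a_x(a_xc_x+b_x^2)$ for some linearly independent linear forms $a_x,b_x,c_x$. Moreover, when these conditions hold, $\operatorname{rank}[f_{xxx}]=5$.
   Context: All forms are homogeneous polynomials with complex coefficients in $x_1,x_2,x_3$ (the zero polynomial is allowed); subscripts indicate degree, so $a_x=a_1x_1+a_2x_2+a_3x_3$ is a linear form and $f_{xxx}$ a cubic form. Let $u_1,u_2,u_3$ be further independent variables and $u_x=u_1x_1+u_2x_2+u_3x_3$. Rank: for a form $f$ of degree $d$, $\operatorname{rank}[f]$ (Waring rank) is the smallest integer $r\ge 0$ such that $f$ is a sum of $r$ $d$-th powers of linear forms in $\mathbb{C}[x_1,x_2,x_3]$. Transvectants: for forms $f,g,h$ in $x_1,x_2,x_3$ (whose coefficients may be polynomials in $u_1,u_2,u_3$, treated as constants), $\mathcal{J}_n[f,g,h]$ is obtained by applying $\Omega^n$ to $f(x)g(y)h(z)$, where $x,y,z$ are three independent triples of variables and $\Omega$ is the differential operator given by the $3\times 3$ determinant with rows $(\partial/\partial x_i)_i$, $(\partial/\partial y_i)_i$, $(\partial/\partial z_i)_i$, and then setting $y=z=x$. Concomitants: the Hessian of $f_{xxx}$ is the cubic form $\Delta_{xxx}=\frac1{12}\mathcal{J}_2[f_{xxx},f_{xxx},f_{xxx}]$, and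 $\theta^{\Delta}_{uuxx}=\frac14\mathcal{J}_2[\Delta_{xxx},\Delta_{xxx},u_x^2]$, a polynomial in $x_1,x_2,x_3,u_1,u_2,u_3$. Equations such as $\theta^{\Delta}_{uuxx}=0$ mean identical vanishing as polynomials. *)

theory Defs
  imports "HOL-Analysis.Analysis" "HOL-Library.Poly_Mapping"
begin

(* Four triples of indeterminates, each indexed by the three-element type 3, whose elements
   1, 2, 3 are distinct (3 = 0 there). *)
datatype indet = X 3 | Y 3 | Z 3 | U 3

(* Complex polynomials in these indeterminates: finitely supported maps from exponent vectors
   to coefficients, with the convolution product of Poly_Mapping. *)
type_synonym cpoly = "(indet \<Rightarrow>\<^sub>0 nat) \<Rightarrow>\<^sub>0 complex"

definition Const :: "complex \<Rightarrow> cpoly" where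
  "Const c = Poly_Mapping.single 0 c"

definition Var :: "indet \<Rightarrow> cpoly" where
  "Var v = Poly_Mapping.single (Poly_Mapping.single v 1) 1"

(* Homogeneous of degree d, in x_1, x_2, x_3 only; the zero polynomial is a form of every
   degree. *)
definition ternary_form :: "nat \<Rightarrow> cpoly \<Rightarrow> bool" where
  "ternary_form d p \<longleftrightarrow>
     (\<forall>m \<in> Poly_Mapping.keys p. Poly_Mapping.keys m \<subseteq> range X \<and>
        (\<Sum>v \<in> Poly_Mapping.keys m. Poly_Mapping.lookup m v) = d)"

definition lin_indep3 :: "cpoly \<Rightarrow> cpoly \<Rightarrow> cpoly \<Rightarrow> bool" where
  "lin_indep3 a b c \<longleftrightarrow>
     (\<forall>r s t. Const r * a + Const s * b + Const t * c = 0 \<longrightarrow> r = 0 \<and> s = 0 \<and> t = 0)"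

definition waring_rank :: "nat \<Rightarrow> cpoly \<Rightarrow> nat" where
  "waring_rank d f =
     (LEAST r. \<exists>l :: nat \<Rightarrow> cpoly. (\<forall>i<r. ternary_form 1 (l i)) \<and> f = (\<Sum>i<r. l i ^ d))"

(* Where v does not occur in m, the truncated difference m - v is harmless: the coefficient
   is 0. *)
definition pdiff :: "indet \<Rightarrow> cpoly \<Rightarrow> cpoly" where
  "pdiff v p =
     (\<Sum>m \<in> Poly_Mapping.keys p.
        Poly_Mapping.single (m - Poly_Mapping.single v 1)
          (of_nat (Poly_Mapping.lookup m v) * Poly_Mapping.lookup p m))"

definition subst_indets :: "(indet \<Rightarrow> indet) \<Rightarrow> cpoly \<Rightarrow> cpoly" where
  "subst_indets \<sigma> p =
     (\<Sum>m \<in> Poly_Mapping.keys p.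
        Const (Poly_Mapping.lookup p m) *
          (\<Prod>v \<in> Poly_Mapping.keys m. Var (\<sigma> v) ^ Poly_Mapping.lookup m v))"

fun x_to_y :: "indet \<Rightarrow> indet" where
  "x_to_y (X i) = Y i"
| "x_to_y v = v"

fun x_to_z :: "indet \<Rightarrow> indet" where
  "x_to_z (X i) = Z i"
| "x_to_z v = v"

fun yz_to_x :: "indet \<Rightarrow> indet" where
  "yz_to_x (Y i) = X i"
| "yz_to_x (Z i) = X i"
| "yz_to_x v = v"

(* The 3 x 3 determinant with rows (d/dx_i), (d/dy_i), (d/dz_i), written out. *)
definition Omega :: "cpoly \<Rightarrow> cpoly" where
  "Omega p =
     (let D = (\<lambda>i j k. pdiff (X i) (pdiff (Y j) (pdiff (Z k) p)))
      in D 1 2 3 + D 2 3 1 + D 3 1 2 - D 1 3 2 - D 2 1 3 - D 3 2 1)"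

(* Meant for f, g, h in the indeterminates X and U only; U is treated as constant. *)
definition transvectant :: "nat \<Rightarrow> cpoly \<Rightarrow> cpoly \<Rightarrow> cpoly \<Rightarrow> cpoly" where
  "transvectant n f g h =
     subst_indets yz_to_x ((Omega ^^ n) (f * subst_indets x_to_y g * subst_indets x_to_z h))"

definition u_x :: cpoly where
  "u_x = (\<Sum>i\<in>UNIV. Var (U i) * Var (X i))"

definition hessian :: "cpoly \<Rightarrow> cpoly" where
  "hessian f = Const (1/12) * transvectant 2 f f f"

(* theta applied to the Hessian of f is the concomitant theta^Delta_{uuxx}. *)
definition theta :: "cpoly \<Rightarrow> cpoly" where
  "theta g = Const (1/4) * transvectant 2 g g (u_x ^ 2)"

end

theory Submission
  imports Defs
begin

text \<open>
  Write a cubic form as $f(x) = T(x,x,x)$ with a symmetric trilinear $T$; its Hessian matrix at $x$ is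
  $6\,T(x,\cdot,\cdot)$, so $\Delta$ is a multiple of $\det T(x,\cdot,\cdot)$ and, for $\Delta$ in
  place of $f$, $\theta(x, s \times t)$ is a multiple of $T(x,s,s)\,T(x,t,t) - T(x,s,t)^2$.

  (1) $\Rightarrow$ (2): if $\theta = 0$, fix $p$ with $\Delta(p) \neq 0$; the $2 \times 2$ minors give
  $\Delta(p)^2\,\Delta(q) = T(p,p,q)^3$ for all $q$.

  (2) $\Rightarrow$ (3): let $V$ be the kernel of $a$. For $p \in V$ the matrix $T(p,\cdot,\cdot)$ is
  singular, with kernel vector $v$, and then $T(v,p,\cdot) = 0$ puts $v$ in $V$ as well. Since
  $V$ is a plane, this forces $T(p,p,\cdot) = 0$ for some nonzero $p \in V$. In a basis $e, p, q$ with
  $V = \langle p, q \rangle$ the condition that the Hessian is a multiple of $a^3$ kills all coefficients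
  of $f$ but those of a conic with a tangent line.

  Rank: $xy^2 + x^2z$ is a combination of the cubes of $x \pm y + z$, $x \pm iy - z$ and $z$. If $f$
  were a sum of cubes of $l_1,\dots,l_4$, its Hessian would vanish where two of the $l_i$ do, so $a$
  would vanish on all $l_i \times l_j$; this forces a common zero of all $l_i$, whence $\Delta = 0$.
\<close>

subsection \<open>Substitution, evaluation and derivatives\<close>

text \<open>Insertion at a fresh exponent is addition of a monomial, so additive statements about
  polynomials reduce to single monomials. Bilinear ones follow by inducting on each factor in
  turn.\<close>

lemma cpoly_induct [case_names zero add_single]:
  assumes "P (0 :: cpoly)"
    and "\<And>m c p. P p \<Longrightarrow> P (Poly_Mapping.single m c + p)"
  shows "P p"
proof (induction p rule: Poly_Mapping.update_induct)
  case (update p m c)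
  have "Poly_Mapping.update m c p = Poly_Mapping.single m c + p"
    using update(1)
    by (intro poly_mapping_eqI)
      (auto simp: lookup_add lookup_update lookup_single in_keys_iff when_def)
  then show ?case using assms(2) update by metis
qed (rule assms(1))

text \<open>The coefficient map \<open>k\<close> is a parameter so that one development serves both
  uses: \<open>Const\<close> gives the renaming of indeterminates, the identity gives numerical
  evaluation.\<close>

definition insertion :: "(complex \<Rightarrow> 'b::comm_ring_1) \<Rightarrow> (indet \<Rightarrow> 'b) \<Rightarrow> cpoly \<Rightarrow> 'b" where
  "insertion k \<rho> p = (\<Sum>m \<in> Poly_Mapping.keys p. k (Poly_Mapping.lookup p m) *
      (\<Prod>v \<in> Poly_Mapping.keys m. \<rho> v ^ Poly_Mapping.lookup m v))"

locale coeff_hom =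
  fixes k :: "complex \<Rightarrow> 'b::comm_ring_1"
  assumes k_add: "k (x + y) = k x + k y"
    and k_mult: "k (x * y) = k x * k y"
    and k_one: "k 1 = 1"
begin

lemma k_zero: "k 0 = 0"
  using k_add[of 0 0] by simp

lemma insertion_zero: "insertion k \<rho> 0 = 0"
  by (simp add: insertion_def)

lemma insertion_single:
  "insertion k \<rho> (Poly_Mapping.single m c) =
     k c * (\<Prod>v \<in> Poly_Mapping.keys m. \<rho> v ^ Poly_Mapping.lookup m v)"
  by (simp add: insertion_def k_zero)

lemma insertion_add: "insertion k \<rho> (p + q) = insertion k \<rho> p + insertion k \<rho> q"
  unfolding insertion_def
  by (rule setsum_keys_plus_distrib) (simp_all add: k_zero k_add algebra_simps)

lemma insertion_single_mult:
  "insertion k \<rho> (Poly_Mapping.single m c * Poly_Mapping.single n d) =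
     insertion k \<rho> (Poly_Mapping.single m c) * insertion k \<rho> (Poly_Mapping.single n d)"
proof -
  let ?K = "Poly_Mapping.keys m \<union> Poly_Mapping.keys n"
  \<comment> \<open>Indices outside the keys have exponent 0 and contribute a factor 1, so all three
    products can run over the same set.\<close>
  have *: "(\<Prod>v \<in> Poly_Mapping.keys m'. \<rho> v ^ Poly_Mapping.lookup m' v) =
      (\<Prod>v \<in> ?K. \<rho> v ^ Poly_Mapping.lookup m' v)"
    if "Poly_Mapping.keys m' \<subseteq> ?K" for m' :: "indet \<Rightarrow>\<^sub>0 nat"
    using that by (intro prod.mono_neutral_left) (auto simp: in_keys_iff)
  have "Poly_Mapping.keys (m + n) = ?K"
    by (auto simp: in_keys_iff lookup_add)
  then show ?thesis
    by (simp add: mult_single insertion_single k_mult *[of m] *[of n]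
        lookup_add power_add prod.distrib mult_ac)
qed

lemma insertion_mult: "insertion k \<rho> (p * q) = insertion k \<rho> p * insertion k \<rho> q"
proof (induction p rule: cpoly_induct)
  case (add_single m c p)
  have "insertion k \<rho> (Poly_Mapping.single m c * q) =
      insertion k \<rho> (Poly_Mapping.single m c) * insertion k \<rho> q"
    by (induction q rule: cpoly_induct)
      (simp_all add: insertion_zero insertion_add insertion_single_mult ring_distribs)
  then show ?case
    using add_single by (simp add: insertion_add ring_distribs)
qed (simp add: insertion_zero)

lemma insertion_Const: "insertion k \<rho> (Const c) = k c"
  by (simp add: Const_def insertion_single)

lemma insertion_Var: "insertion k \<rho> (Var v) = \<rho> v"
  by (simp add: Var_def insertion_single k_one)

end

lemma Const_add: "Const (x + y) = Const x + Const y"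
  by (simp add: Const_def single_add)

lemma Const_mult: "Const (x * y) = Const x * Const y"
  by (simp add: Const_def mult_single)

lemma Const_zero [simp]: "Const 0 = 0"
  by (simp add: Const_def)

lemma Const_one [simp]: "Const 1 = 1"
  by (simp add: Const_def)

lemma Const_numeral: "Const (numeral n) = numeral n"
  by (simp add: Const_def)

lemma Const_minus: "Const (- x) = - Const x"
  by (simp add: Const_def single_uminus)

interpretation Const: coeff_hom Const
  by standard (simp_all add: Const_add Const_mult)

interpretation cid: coeff_hom "\<lambda>c :: complex. c"
  by standard simp_all

lemma subst_indets_eq: "subst_indets \<sigma> = insertion Const (\<lambda>v. Var (\<sigma> v))"
  by (simp add: fun_eq_iff subst_indets_def insertion_def)

lemma subst_add: "subst_indets \<sigma> (p + q) = subst_indets \<sigma> p + subst_indets \<sigma> q"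
  and subst_mult: "subst_indets \<sigma> (p * q) = subst_indets \<sigma> p * subst_indets \<sigma> q"
  and subst_Const: "subst_indets \<sigma> (Const c) = Const c"
  and subst_Var: "subst_indets \<sigma> (Var v) = Var (\<sigma> v)"
  and subst_zero: "subst_indets \<sigma> 0 = 0"
  by (simp_all add: subst_indets_eq Const.insertion_add Const.insertion_mult
      Const.insertion_Const Const.insertion_Var Const.insertion_zero)

lemma subst_diff: "subst_indets \<sigma> (p - q) = subst_indets \<sigma> p - subst_indets \<sigma> q"
  using subst_add[of \<sigma> "p - q" q] by simp

definition eval :: "(indet \<Rightarrow> complex) \<Rightarrow> cpoly \<Rightarrow> complex" where
  "eval = insertion (\<lambda>c. c)"

lemma eval_add [simp]: "eval \<rho> (p + q) = eval \<rho> p + eval \<rho> q"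
  and eval_mult [simp]: "eval \<rho> (p * q) = eval \<rho> p * eval \<rho> q"
  and eval_Const [simp]: "eval \<rho> (Const c) = c"
  and eval_Var [simp]: "eval \<rho> (Var v) = \<rho> v"
  and eval_zero [simp]: "eval \<rho> 0 = 0"
  by (simp_all add: eval_def cid.insertion_add cid.insertion_mult
      cid.insertion_Const cid.insertion_Var cid.insertion_zero)

lemma eval_diff [simp]: "eval \<rho> (p - q) = eval \<rho> p - eval \<rho> q"
  using eval_add[of \<rho> "p - q" q] by simp

lemma eval_one [simp]: "eval \<rho> 1 = 1"
  using eval_Const[of \<rho> 1] by simp

lemma eval_numeral [simp]: "eval \<rho> (numeral n) = numeral n"
  using eval_Const[of \<rho> "numeral n"] by (simp add: Const_numeral)

lemma eval_power [simp]: "eval \<rho> (p ^ n) = eval \<rho> p ^ n"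
  by (induction n) simp_all

lemma eval_sum [simp]: "eval \<rho> (sum g A) = (\<Sum>i\<in>A. eval \<rho> (g i))"
  by (induction A rule: infinite_finite_induct) simp_all

section \<open>Formal partial derivatives\<close>

lemma pdiff_add: "pdiff v (p + q) = pdiff v p + pdiff v q"
  unfolding pdiff_def
  by (rule setsum_keys_plus_distrib) (simp_all add: single_add [symmetric] algebra_simps)

lemma pdiff_zero [simp]: "pdiff v 0 = 0"
  by (simp add: pdiff_def)

lemma pdiff_diff: "pdiff v (p - q) = pdiff v p - pdiff v q"
  using pdiff_add[of v "p - q" q] by simp

lemma pdiff_single:
  "pdiff v (Poly_Mapping.single m c) =
     Poly_Mapping.single (m - Poly_Mapping.single v 1) (of_nat (Poly_Mapping.lookup m v) * c)"
  by (simp add: pdiff_def)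

text \<open>Truncated subtraction commutes with adding \<open>n\<close> only if \<open>v\<close>
  occurs in \<open>m\<close>; if it does not, both coefficients are 0.\<close>

lemma pdiff_single_mult_aux:
  "Poly_Mapping.single (m + n - Poly_Mapping.single v 1)
     (of_nat (Poly_Mapping.lookup m v) * (c * d)) =
   Poly_Mapping.single (m - Poly_Mapping.single v 1 + n)
     (of_nat (Poly_Mapping.lookup m v) * (c * d :: complex))"
proof (cases "Poly_Mapping.lookup m v = 0")
  case False
  then have "m + n - Poly_Mapping.single v 1 = m - Poly_Mapping.single v 1 + n"
    by (intro poly_mapping_eqI) (auto simp: lookup_add lookup_minus lookup_single when_def)
  then show ?thesis by simp
qed simp

lemma pdiff_single_mult:
  fixes m n :: "indet \<Rightarrow>\<^sub>0 nat" and c d :: complex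
  defines "s \<equiv> Poly_Mapping.single m c" and "t \<equiv> Poly_Mapping.single n d"
  shows "pdiff v (s * t) = pdiff v s * t + s * pdiff v t"
  using pdiff_single_mult_aux[of m n v c d] pdiff_single_mult_aux[of n m v c d]
  by (simp add: s_def t_def mult_single pdiff_single lookup_add ring_distribs single_add
      mult_ac add_ac)

lemma pdiff_mult: "pdiff v (p * q) = pdiff v p * q + p * pdiff v q"
proof (induction p rule: cpoly_induct)
  case (add_single m c p)
  have "pdiff v (Poly_Mapping.single m c * q) =
      pdiff v (Poly_Mapping.single m c) * q + Poly_Mapping.single m c * pdiff v q"
    by (induction q rule: cpoly_induct)
      (simp_all add: pdiff_add pdiff_single_mult ring_distribs)
  then show ?case
    using add_single by (simp add: pdiff_add ring_distribs)
qed simp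

lemma pdiff_Const [simp]: "pdiff v (Const c) = 0"
  by (simp add: Const_def pdiff_single)

lemma pdiff_Var: "pdiff v (Var w) = (if v = w then 1 else 0)"
  by (simp add: Var_def pdiff_single lookup_single when_def)

lemma pdiff_sum: "pdiff v (sum g A) = (\<Sum>i\<in>A. pdiff v (g i))"
  by (induction A rule: infinite_finite_induct) (simp_all add: pdiff_add)

subsection \<open>Second transvectants\<close>

text \<open>Polynomials in \<^const>\<open>X\<close> and \<^const>\<open>U\<close> only, on which transvectants are meant to act.\<close>

inductive_set XU :: "cpoly set" where
  XU_Const: "Const c \<in> XU"
| XU_X: "Var (X i) \<in> XU"
| XU_U: "Var (U i) \<in> XU"
| XU_add: "p \<in> XU \<Longrightarrow> q \<in> XU \<Longrightarrow> p + q \<in> XU"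
| XU_mult: "p \<in> XU \<Longrightarrow> q \<in> XU \<Longrightarrow> p * q \<in> XU"

lemma XU_zero: "0 \<in> XU" and XU_one: "1 \<in> XU"
  using XU_Const[of 0] XU_Const[of 1] by simp_all

lemma XU_sum: "(\<And>i. i \<in> A \<Longrightarrow> g i \<in> XU) \<Longrightarrow> sum g A \<in> XU"
  by (induction A rule: infinite_finite_induct) (simp_all add: XU_zero XU_add)

lemma XU_power: "p \<in> XU \<Longrightarrow> p ^ n \<in> XU"
  by (induction n) (simp_all add: XU_one XU_mult)

lemma pdiff_X_in_XU: "p \<in> XU \<Longrightarrow> pdiff (X i) p \<in> XU"
  by (induction rule: XU.induct)
    (simp_all add: pdiff_add pdiff_mult pdiff_Var XU.intros XU_zero XU_one)

abbreviation (input) xy :: "cpoly \<Rightarrow> cpoly" where "xy \<equiv> subst_indets x_to_y"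
abbreviation (input) xz :: "cpoly \<Rightarrow> cpoly" where "xz \<equiv> subst_indets x_to_z"

text \<open>A renamed copy is constant for the other two triples, and identifying the triples again
  undoes the renaming. All facts pass through sums and products, so one induction proves them
  together.\<close>

lemma XU_rename:
  assumes "p \<in> XU"
  shows pdiff_Y_XU: "pdiff (Y i) p = 0" and pdiff_Z_XU: "pdiff (Z i) p = 0"
    and pdiff_X_xy: "pdiff (X i) (xy p) = 0" and pdiff_Y_xy: "pdiff (Y i) (xy p) = xy (pdiff (X i) p)"
    and pdiff_Z_xy: "pdiff (Z i) (xy p) = 0"
    and pdiff_X_xz: "pdiff (X i) (xz p) = 0" and pdiff_Y_xz: "pdiff (Y i) (xz p) = 0"
    and pdiff_Z_xz: "pdiff (Z i) (xz p) = xz (pdiff (X i) p)"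
    and yz_to_x_XU: "subst_indets yz_to_x p = p"
    and yz_to_x_xy: "subst_indets yz_to_x (xy p) = p"
    and yz_to_x_xz: "subst_indets yz_to_x (xz p) = p"
  using assms
  by (induction rule: XU.induct)
    (simp_all add: pdiff_add pdiff_mult pdiff_Var subst_add subst_mult subst_Const subst_Var
      subst_zero subst_Const[of _ 1, simplified])

definition xyz :: "cpoly \<Rightarrow> cpoly \<Rightarrow> cpoly \<Rightarrow> cpoly" where
  "xyz f g h = f * xy g * xz h"

lemma pdiff_xyz:
  assumes "f \<in> XU" "g \<in> XU" "h \<in> XU"
  shows "pdiff (X i) (xyz f g h) = xyz (pdiff (X i) f) g h"
    and "pdiff (Y i) (xyz f g h) = xyz f (pdiff (X i) g) h"
    and "pdiff (Z i) (xyz f g h) = xyz f g (pdiff (X i) h)"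
  using assms by (simp_all add: xyz_def pdiff_mult XU_rename)

abbreviation dx :: "3 \<Rightarrow> cpoly \<Rightarrow> cpoly" where "dx i \<equiv> pdiff (X i)"

lemma Omega_xyz:
  assumes "f \<in> XU" "g \<in> XU" "h \<in> XU"
  shows "Omega (xyz f g h) =
    xyz (dx 1 f) (dx 2 g) (dx 3 h) + xyz (dx 2 f) (dx 3 g) (dx 1 h) + xyz (dx 3 f) (dx 1 g) (dx 2 h)
    - xyz (dx 1 f) (dx 3 g) (dx 2 h) - xyz (dx 2 f) (dx 1 g) (dx 3 h) - xyz (dx 3 f) (dx 2 g) (dx 1 h)"
  using assms by (simp add: Omega_def Let_def pdiff_xyz pdiff_X_in_XU)

lemma Omega_add: "Omega (p + q) = Omega p + Omega q"
  and Omega_diff: "Omega (p - q) = Omega p - Omega q"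
  by (simp_all add: Omega_def Let_def pdiff_add pdiff_diff)

lemma yz_to_x_xyz:
  assumes "f \<in> XU" "g \<in> XU" "h \<in> XU"
  shows "subst_indets yz_to_x (xyz f g h) = f * g * h"
  using assms by (simp add: xyz_def subst_mult XU_rename)

definition dxx :: "cpoly \<Rightarrow> 3 \<Rightarrow> 3 \<Rightarrow> cpoly" where
  "dxx f i j = dx i (dx j f)"

text \<open>Each \<open>Omega\<close> acts factorwise on f(x)g(y)h(z). The arguments of
  \<open>S\<close> come from the first application, the explicit indices in its body from the
  second; both run over signed permutations.\<close>

lemma transvectant_2:
  assumes "f \<in> XU" "g \<in> XU" "h \<in> XU"
  shows "transvectant 2 f g h =
    (let S = (\<lambda>i j k.
       dxx f 1 i * dxx g 2 j * dxx h 3 k + dxx f 2 i * dxx g 3 j * dxx h 1 k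
       + dxx f 3 i * dxx g 1 j * dxx h 2 k - dxx f 1 i * dxx g 3 j * dxx h 2 k
       - dxx f 2 i * dxx g 1 j * dxx h 3 k - dxx f 3 i * dxx g 2 j * dxx h 1 k)
     in S 1 2 3 + S 2 3 1 + S 3 1 2 - S 1 3 2 - S 2 1 3 - S 3 2 1)"
    (is "_ = ?S")
proof -
  have "transvectant 2 f g h = subst_indets yz_to_x (Omega (Omega (xyz f g h)))"
    by (simp add: transvectant_def xyz_def numeral_2_eq_2)
  also have "\<dots> = ?S"
    using assms
    by (simp only: Omega_xyz Omega_add Omega_diff pdiff_X_in_XU subst_add subst_diff
        yz_to_x_xyz dxx_def Let_def)
  finally show ?thesis .
qed

subsection \<open>Ternary forms\<close>

abbreviation deg :: "(indet \<Rightarrow>\<^sub>0 nat) \<Rightarrow> nat" where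
  "deg m \<equiv> (\<Sum>v \<in> Poly_Mapping.keys m. Poly_Mapping.lookup m v)"

lemma deg_add: "deg (m + n) = deg m + deg n"
  by (rule setsum_keys_plus_distrib) simp_all

lemma ternary_form_add: "ternary_form d p \<Longrightarrow> ternary_form d q \<Longrightarrow> ternary_form d (p + q)"
  using keys_add[of p q] by (auto simp: ternary_form_def)

lemma ternary_form_mult:
  assumes "ternary_form d p" "ternary_form e q"
  shows "ternary_form (d + e) (p * q)"
  unfolding ternary_form_def
proof
  fix k assume "k \<in> Poly_Mapping.keys (p * q)"
  then obtain m n where k: "k = m + n" and mn: "m \<in> Poly_Mapping.keys p" "n \<in> Poly_Mapping.keys q"
    using keys_mult[of p q] by blast
  have "Poly_Mapping.keys m \<subseteq> range X" "deg m = d" "Poly_Mapping.keys n \<subseteq> range X" "deg n = e"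
    using assms mn by (simp_all add: ternary_form_def)
  moreover have "Poly_Mapping.keys k \<subseteq> Poly_Mapping.keys m \<union> Poly_Mapping.keys n"
    unfolding k by (rule keys_add)
  moreover have "deg k = deg m + deg n"
    unfolding k by (rule deg_add)
  ultimately show "Poly_Mapping.keys k \<subseteq> range X \<and> deg k = d + e"
    by blast
qed

lemma ternary_form_zero [simp]: "ternary_form d 0"
  by (simp add: ternary_form_def)

lemma ternary_form_Const: "ternary_form 0 (Const c)"
  by (auto simp: ternary_form_def Const_def)

lemma ternary_form_Var: "ternary_form 1 (Var (X i))"
  by (auto simp: ternary_form_def Var_def)

lemma ternary_form_Const_mult: "ternary_form d p \<Longrightarrow> ternary_form d (Const c * p)"
  using ternary_form_mult[OF ternary_form_Const] by simp

lemma ternary_form_power: "ternary_form 1 p \<Longrightarrow> ternary_form n (p ^ n)"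
  by (induction n)
    (use ternary_form_Const[of 1] ternary_form_mult[of 1 p] in \<open>simp_all\<close>)

lemma ternary_form_diff:
  assumes "ternary_form d p" "ternary_form d q"
  shows "ternary_form d (p - q)"
  using ternary_form_add[OF assms(1) ternary_form_Const_mult[OF assms(2), of "-1"]]
  by (simp add: Const_minus)

lemma ternary_form_sum: "(\<And>i. i \<in> A \<Longrightarrow> ternary_form d (g i)) \<Longrightarrow> ternary_form d (sum g A)"
  by (induction A rule: infinite_finite_induct) (simp_all add: ternary_form_add)

lemma sum_single: "(\<Sum>m \<in> Poly_Mapping.keys p. Poly_Mapping.single m (Poly_Mapping.lookup p m)) = p"
  by (intro poly_mapping_eqI) (simp add: lookup_sum lookup_single when_def in_keys_iff)

lemma monomial_split:
  assumes "Poly_Mapping.keys m \<subseteq> range X" "deg m = Suc d"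
  obtains i n where "m = Poly_Mapping.single (X i) 1 + n" "Poly_Mapping.keys n \<subseteq> range X" "deg n = d"
proof -
  obtain v where v: "v \<in> Poly_Mapping.keys m"
    using assms(2) by fastforce
  then obtain i where i: "v = X i" using assms(1) by auto
  define n where "n = m - Poly_Mapping.single (X i) 1"
  have m: "m = Poly_Mapping.single (X i) 1 + n"
    using v unfolding n_def i
    by (intro poly_mapping_eqI) (auto simp: lookup_add lookup_minus lookup_single when_def in_keys_iff)
  have "Poly_Mapping.keys n \<subseteq> Poly_Mapping.keys m"
    unfolding n_def by (auto simp: in_keys_iff lookup_minus)
  moreover have "deg n = d"
    using assms(2) by (simp add: m deg_add del: One_nat_def)
  ultimately show ?thesis using that m assms(1) by blast
qed

text \<open>Each monomial gives up one of its variables, chosen arbitrarily. Repeated splitting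
  turns a form into a tensor of coefficients.\<close>

lemma ternary_form_split:
  assumes "ternary_form (Suc d) p"
  shows "\<exists>q. (\<forall>i. ternary_form d (q i)) \<and> p = (\<Sum>i\<in>UNIV. Var (X i) * q i)"
proof -
  have "\<exists>q. (\<forall>i. ternary_form d (q i)) \<and>
      Poly_Mapping.single m (Poly_Mapping.lookup p m) = (\<Sum>i\<in>UNIV. Var (X i) * q i)"
    if "m \<in> Poly_Mapping.keys p" for m
  proof -
    have "Poly_Mapping.keys m \<subseteq> range X" "deg m = Suc d"
      using that assms by (simp_all add: ternary_form_def)
    then obtain i n where m: "m = Poly_Mapping.single (X i) 1 + n"
      and n: "Poly_Mapping.keys n \<subseteq> range X" "deg n = d"
      by (rule monomial_split)
    let ?q = "Poly_Mapping.single n (Poly_Mapping.lookup p m)"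
    have "(\<Sum>j\<in>UNIV. Var (X j) * (if j = i then ?q else 0)) = Var (X i) * ?q"
      by (simp add: if_distrib cong: if_cong)
    also have "\<dots> = Poly_Mapping.single m (Poly_Mapping.lookup p m)"
      using m by (simp add: Var_def mult_single)
    finally show ?thesis
      using n by (intro exI[of _ "\<lambda>j. if j = i then ?q else 0"]) (auto simp: ternary_form_def)
  qed
  then obtain q where q: "\<And>m. m \<in> Poly_Mapping.keys p \<Longrightarrow> (\<forall>i. ternary_form d (q m i)) \<and>
      Poly_Mapping.single m (Poly_Mapping.lookup p m) = (\<Sum>i\<in>UNIV. Var (X i) * q m i)"
    by metis
  have "p = (\<Sum>m \<in> Poly_Mapping.keys p. \<Sum>i\<in>UNIV. Var (X i) * q m i)"
    using q sum_single[of p] by (metis (no_types, lifting) sum.cong)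
  also have "\<dots> = (\<Sum>i\<in>UNIV. Var (X i) * (\<Sum>m \<in> Poly_Mapping.keys p. q m i))"
    by (subst sum.swap) (simp add: sum_distrib_left)
  finally show ?thesis
    using q by (intro exI[of _ "\<lambda>i. \<Sum>m \<in> Poly_Mapping.keys p. q m i"]) (simp add: ternary_form_sum)
qed

lemma ternary_form_0: "ternary_form 0 p \<Longrightarrow> \<exists>c. p = Const c"
proof -
  assume p: "ternary_form 0 p"
  have "m = 0" if "m \<in> Poly_Mapping.keys p" for m
  proof -
    have "\<forall>v \<in> Poly_Mapping.keys m. Poly_Mapping.lookup m v = 0"
      using that p by (simp add: ternary_form_def)
    then have "Poly_Mapping.lookup m v = 0" for v
      by (cases "v \<in> Poly_Mapping.keys m") (auto simp: in_keys_iff)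
    then show ?thesis by (intro poly_mapping_eqI) simp
  qed
  then have "Poly_Mapping.lookup p m = Poly_Mapping.lookup (Const (Poly_Mapping.lookup p 0)) m" for m
    by (cases "m = 0") (auto simp: Const_def lookup_single in_keys_iff)
  then show ?thesis using poly_mapping_eqI by blast
qed

section \<open>Linear, quadratic and cubic forms given by coefficient tensors\<close>

definition lin :: "complex^3 \<Rightarrow> cpoly" where
  "lin l = (\<Sum>i\<in>UNIV. Var (X i) * Const (l $ i))"

lemma ternary_form_1_iff: "ternary_form 1 p \<longleftrightarrow> (\<exists>l. p = lin l)"
proof
  assume "ternary_form 1 p"
  then obtain q where q: "\<And>i. ternary_form 0 (q i)" "p = (\<Sum>i\<in>UNIV. Var (X i) * q i)"
    using ternary_form_split[of 0 p] unfolding One_nat_def by blast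
  have "\<forall>i. \<exists>c. q i = Const c"
    using q(1) ternary_form_0 by blast
  then obtain l where "\<And>i. q i = Const (l i)"
    by metis
  then have "p = lin (\<chi> i. l i)" by (simp add: q lin_def)
  then show "\<exists>l. p = lin l" ..
qed (auto simp: lin_def mult.commute[of "Var _"] intro!: ternary_form_sum ternary_form_Const_mult
    ternary_form_Var simp del: One_nat_def)

definition quad :: "(3 \<Rightarrow> 3 \<Rightarrow> complex) \<Rightarrow> cpoly" where
  "quad Q = (\<Sum>i\<in>UNIV. Var (X i) * lin (\<chi> j. Q i j))"

definition cub :: "(3 \<Rightarrow> 3 \<Rightarrow> 3 \<Rightarrow> complex) \<Rightarrow> cpoly" where
  "cub T = (\<Sum>i\<in>UNIV. Var (X i) * quad (T i))"

definition sym3 :: "(3 \<Rightarrow> 3 \<Rightarrow> 3 \<Rightarrow> complex) \<Rightarrow> bool" where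
  "sym3 T \<longleftrightarrow> (\<forall>i j k. T i j k = T j i k \<and> T i j k = T i k j)"

lemma lin_add: "lin (a + b) = lin a + lin b"
  by (simp add: lin_def Const_add ring_distribs sum.distrib)

lemma lin_scale: "lin (c *s a) = Const c * lin a"
  by (simp add: lin_def Const_mult sum_distrib_left mult_ac)

lemma cub_expand:
  "cub T = (\<Sum>i\<in>UNIV. \<Sum>j\<in>UNIV. \<Sum>k\<in>UNIV. Const (T i j k) * (Var (X i) * Var (X j) * Var (X k)))"
  by (simp add: cub_def quad_def lin_def sum_distrib_left mult_ac)

text \<open>Three splittings give some tensor \<open>S\<close>; averaging it over the six
  permutations of the indices makes it symmetric and leaves the form unchanged.\<close>

lemma ternary_form_3_cub:
  assumes "ternary_form 3 p"
  obtains T where "sym3 T" "p = cub T"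
proof -
  obtain q1 where q1: "\<And>i. ternary_form 2 (q1 i)" "p = (\<Sum>i\<in>UNIV. Var (X i) * q1 i)"
    using ternary_form_split[of 2 p] assms by (auto simp: eval_nat_numeral)
  have "\<exists>q. (\<forall>j. ternary_form 1 (q j)) \<and> q1 i = (\<Sum>j\<in>UNIV. Var (X j) * q j)" for i
    using q1(1) ternary_form_split[of 1 "q1 i"] by (simp add: numeral_2_eq_2)
  then obtain q2 where q2: "\<And>i j. ternary_form 1 (q2 i j)"
      "\<And>i. q1 i = (\<Sum>j\<in>UNIV. Var (X j) * q2 i j)"
    by metis
  obtain l where l: "\<And>i j. q2 i j = lin (l i j)"
    using q2(1)[unfolded ternary_form_1_iff] by metis
  define S where "S = (\<lambda>i j k. l i j $ k)"
  define T where "T = (\<lambda>i j k. (S i j k + S i k j + S j i k + S j k i + S k i j + S k j i) / 6)"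
  have "p = cub S"
    by (simp add: q1(2) q2(2) l cub_def quad_def S_def)
  also have "\<dots> = cub T"
  proof -
    have "Const 6 * Const (T i j k) = Const (S i j k) + Const (S i k j) + Const (S j i k)
        + Const (S j k i) + Const (S k i j) + Const (S k j i)" for i j k
      unfolding Const_mult [symmetric] Const_add [symmetric]
      by (rule arg_cong[of _ _ Const]) (simp add: T_def field_simps)
    \<comment> \<open>The factor 6 clears the denominator of the average; it is cancelled below by
      multiplying with \<open>Const (1/6)\<close>.\<close>
    then have "Const 6 * cub T = Const 6 * cub S"
      unfolding cub_expand sum_distrib_left mult.assoc [symmetric]
      by (simp add: sum_3 Const_numeral algebra_simps)
    then have "Const (1/6 * 6) * cub T = Const (1/6 * 6) * cub S"
      unfolding Const_mult mult.assoc by simp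
    then show ?thesis by simp
  qed
  finally have "p = cub T" .
  moreover have "sym3 T"
    by (simp add: sym3_def T_def algebra_simps)
  ultimately show ?thesis using that by blast
qed

lemma delta_mult:
  "(if b then 1 else 0) * p = (if b then p else 0)" "p * (if b then 1 else 0) = (if b then p else 0)"
  for p :: "'a::semiring_1"
  by simp_all

lemma dx_lin: "dx a (lin l) = Const (l $ a)"
  by (simp add: lin_def pdiff_sum pdiff_mult pdiff_Var delta_mult)

lemma dx_quad:
  assumes "\<And>i j. Q i j = Q j i"
  shows "dx a (quad Q) = 2 * lin (\<chi> j. Q a j)"
proof -
  have "dx a (quad Q) = lin (\<chi> j. Q a j) + (\<Sum>i\<in>UNIV. Var (X i) * Const (Q i a))"
    by (simp add: quad_def pdiff_sum pdiff_mult pdiff_Var dx_lin sum.distrib delta_mult)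
  also have "(\<Sum>i\<in>UNIV. Var (X i) * Const (Q i a)) = lin (\<chi> j. Q a j)"
    using assms by (simp add: lin_def)
  finally show ?thesis by simp
qed

text \<open>The three index slots contribute equally, by symmetry of \<open>T\<close>.\<close>

lemma dx_cub:
  assumes "sym3 T"
  shows "dx a (cub T) = 3 * quad (T a)"
proof -
  have s: "T i j k = T j i k" "T i j k = T i k j" for i j k
    using assms by (auto simp: sym3_def)
  have "dx a (cub T) = quad (T a) + (\<Sum>i\<in>UNIV. Var (X i) * (2 * lin (\<chi> j. T i a j)))"
    using s by (simp add: cub_def pdiff_sum pdiff_mult pdiff_Var dx_quad sum.distrib delta_mult)
  also have "(\<Sum>i\<in>UNIV. Var (X i) * (2 * lin (\<chi> j. T i a j))) = 2 * quad (T a)"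
    by (simp add: quad_def s(1)[of _ a] sum_distrib_left mult_ac)
  finally show ?thesis by simp
qed

lemma pdiff_numeral [simp]: "pdiff v (numeral n) = 0"
  using pdiff_Const[of v "numeral n"] by (simp add: Const_numeral)

lemma dxx_cub:
  assumes "sym3 T"
  shows "dxx (cub T) i j = 6 * lin (\<chi> k. T i j k)"
proof -
  have s: "T i j k = T j i k" "T i j k = T i k j" for i j k
    using assms by (auto simp: sym3_def)
  show ?thesis
    using s s(1)[of j i] by (simp add: dxx_def dx_cub[OF assms] pdiff_mult dx_quad)
qed

lemma lin_in_XU: "lin l \<in> XU"
  by (auto simp: lin_def intro!: XU_sum XU.intros)

lemma cub_in_XU: "cub T \<in> XU"
  by (auto simp: cub_def quad_def intro!: XU_sum XU.intros lin_in_XU)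

lemma u_x_in_XU: "u_x \<in> XU"
  by (auto simp: u_x_def intro!: XU_sum XU.intros)

lemma dx_u_x: "dx i u_x = Var (U i)"
  by (simp add: u_x_def pdiff_sum pdiff_mult pdiff_Var delta_mult)

lemma dxx_u_x_sq: "dxx (u_x ^ 2) i j = 2 * Var (U i) * Var (U j)"
  by (simp add: dxx_def power2_eq_square pdiff_mult pdiff_add dx_u_x pdiff_Var algebra_simps)

text \<open>The matrix of second derivatives of \<open>cub T\<close> divided by 6, with linear forms
  as entries.\<close>

definition hmat :: "(3 \<Rightarrow> 3 \<Rightarrow> 3 \<Rightarrow> complex) \<Rightarrow> 3 \<Rightarrow> 3 \<Rightarrow> cpoly" where
  "hmat T i j = lin (\<chi> k. T i j k)"

lemma hmat_sym:
  assumes "sym3 T"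
  shows "hmat T 2 1 = hmat T 1 2" "hmat T 3 1 = hmat T 1 3" "hmat T 3 2 = hmat T 2 3"
  using assms by (simp_all add: sym3_def hmat_def)

subsection \<open>The Hessian and the concomitant\<close>

text \<open>The bracket is the determinant of the symmetric matrix \<open>hmat T\<close>. A double
  sum over signed permutations is 3! times a determinant and the second derivatives contribute 6^3,
  so the constant is 6 * 216 / 12 = 108.\<close>

lemma hessian_cub:
  assumes "sym3 T"
  shows "hessian (cub T) = 108 *
    (hmat T 1 1 * hmat T 2 2 * hmat T 3 3 + 2 * hmat T 1 2 * hmat T 1 3 * hmat T 2 3
     - hmat T 1 1 * hmat T 2 3 ^ 2 - hmat T 2 2 * hmat T 1 3 ^ 2 - hmat T 3 3 * hmat T 1 2 ^ 2)"
    (is "_ = 108 * ?d")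
proof -
  have "transvectant 2 (cub T) (cub T) (cub T) = Const 1296 * ?d"
    by (simp add: transvectant_2 cub_in_XU dxx_cub[OF assms] flip: hmat_def)
      (simp add: hmat_sym[OF assms] Const_numeral power2_eq_square algebra_simps)
  then have "hessian (cub T) = Const (1/12 * 1296) * ?d"
    unfolding hessian_def Const_mult by (simp add: mult.assoc)
  then show ?thesis by (simp add: Const_numeral)
qed

text \<open>The bracket is the quadratic form of the adjugate of \<open>hmat T\<close>, evaluated at
  the indeterminates \<open>U\<close>.\<close>

lemma theta_cub:
  assumes "sym3 T"
  shows "theta (cub T) = 36 *
    ((hmat T 2 2 * hmat T 3 3 - hmat T 2 3 ^ 2) * Var (U 1) ^ 2
     + (hmat T 1 1 * hmat T 3 3 - hmat T 1 3 ^ 2) * Var (U 2) ^ 2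
     + (hmat T 1 1 * hmat T 2 2 - hmat T 1 2 ^ 2) * Var (U 3) ^ 2
     + 2 * (hmat T 1 3 * hmat T 2 3 - hmat T 1 2 * hmat T 3 3) * (Var (U 1) * Var (U 2))
     + 2 * (hmat T 1 2 * hmat T 2 3 - hmat T 1 3 * hmat T 2 2) * (Var (U 1) * Var (U 3))
     + 2 * (hmat T 1 2 * hmat T 1 3 - hmat T 2 3 * hmat T 1 1) * (Var (U 2) * Var (U 3)))"
    (is "_ = 36 * ?d")
proof -
  have "transvectant 2 (cub T) (cub T) (u_x ^ 2) = Const 144 * ?d"
    by (simp add: transvectant_2 cub_in_XU u_x_in_XU XU_power dxx_cub[OF assms] dxx_u_x_sq flip: hmat_def)
      (simp add: hmat_sym[OF assms] Const_numeral power2_eq_square algebra_simps)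
  then have "theta (cub T) = Const (1/4 * 144) * ?d"
    unfolding theta_def Const_mult by (simp add: mult.assoc)
  then show ?thesis by (simp add: Const_numeral)
qed

section \<open>Forms as functions on three-space, and the trilinear form of a cubic\<close>

definition ldot :: "complex^3 \<Rightarrow> complex^3 \<Rightarrow> complex" where
  "ldot l x = (\<Sum>i\<in>UNIV. l $ i * x $ i)"

definition tri :: "(3 \<Rightarrow> 3 \<Rightarrow> 3 \<Rightarrow> complex) \<Rightarrow> complex^3 \<Rightarrow> complex^3 \<Rightarrow> complex^3 \<Rightarrow> complex" where
  "tri T u v w = (\<Sum>i\<in>UNIV. \<Sum>j\<in>UNIV. \<Sum>k\<in>UNIV. T i j k * u $ i * v $ j * w $ k)"

lemma ldot_add: "ldot l (x + y) = ldot l x + ldot l y" "ldot (l + m) x = ldot l x + ldot m x"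
  and ldot_scale: "ldot l (c *s x) = c * ldot l x" "ldot (c *s l) x = c * ldot l x"
  by (simp_all add: ldot_def sum_3 algebra_simps)

lemma sum_axis: "(\<Sum>i\<in>UNIV. g i * axis j c $ i) = g j * c" for g :: "'n::finite \<Rightarrow> 'a::semiring_1"
  by (simp add: axis_def if_distrib[of "times _"] cong: if_cong)

lemma ldot_axis: "ldot l (axis i c) = l $ i * c"
  by (simp add: ldot_def sum_axis)

lemma tri_add:
  "tri T (u + u') v w = tri T u v w + tri T u' v w"
  "tri T u (v + v') w = tri T u v w + tri T u v' w"
  "tri T u v (w + w') = tri T u v w + tri T u v w'"
  by (simp_all add: tri_def algebra_simps sum.distrib)

lemma tri_scale:
  "tri T (c *s u) v w = c * tri T u v w"
  "tri T u (c *s v) w = c * tri T u v w"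
  "tri T u v (c *s w) = c * tri T u v w"
  by (simp_all add: tri_def sum_distrib_left mult_ac)

lemma tri_swap:
  assumes "sym3 T"
  shows "tri T u v w = tri T v u w" "tri T u v w = tri T u w v"
proof -
  have s: "T i j k = T j i k" "T i j k = T i k j" for i j k
    using assms by (auto simp: sym3_def)
  have "tri T u v w = (\<Sum>j\<in>UNIV. \<Sum>i\<in>UNIV. \<Sum>k\<in>UNIV. T i j k * u $ i * v $ j * w $ k)"
    unfolding tri_def by (rule sum.swap)
  also have "\<dots> = (\<Sum>j\<in>UNIV. \<Sum>i\<in>UNIV. \<Sum>k\<in>UNIV. T j i k * v $ j * u $ i * w $ k)"
    by (intro sum.cong refl) (simp add: s(1) mult_ac)
  finally show "tri T u v w = tri T v u w" by (simp only: tri_def)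
  have "tri T u v w = (\<Sum>i\<in>UNIV. \<Sum>k\<in>UNIV. \<Sum>j\<in>UNIV. T i j k * u $ i * v $ j * w $ k)"
    unfolding tri_def by (intro sum.cong refl sum.swap)
  also have "\<dots> = (\<Sum>i\<in>UNIV. \<Sum>k\<in>UNIV. \<Sum>j\<in>UNIV. T i k j * u $ i * w $ k * v $ j)"
    by (intro sum.cong refl) (metis s(2) mult.assoc mult.commute)
  finally show "tri T u v w = tri T u w v" by (simp only: tri_def)
qed

lemma tri_nested:
  "tri T u v w = (\<Sum>i\<in>UNIV. (\<Sum>j\<in>UNIV. (\<Sum>k\<in>UNIV. T i j k * w $ k) * v $ j) * u $ i)"
  by (simp add: tri_def sum_distrib_left mult_ac)

lemma tri_axis_12: "tri T (axis i 1) (axis j 1) w = (\<Sum>k\<in>UNIV. T i j k * w $ k)"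
  by (simp add: tri_nested sum_axis)

lemma tri_axis: "tri T (axis i 1) (axis j 1) (axis k 1) = T i j k"
  by (simp add: tri_axis_12 sum_axis)

text \<open>Inclusion and exclusion leaves only the six terms that use each of \<open>u\<close>,
  \<open>v\<close>, \<open>w\<close> once.\<close>

lemma polarization:
  assumes "sym3 T"
  shows "6 * tri T u v w = tri T (u + v + w) (u + v + w) (u + v + w)
    - tri T (u + v) (u + v) (u + v) - tri T (u + w) (u + w) (u + w) - tri T (v + w) (v + w) (v + w)
    + tri T u u u + tri T v v v + tri T w w w"
proof -
  have 1: "tri T v u w = tri T u v w" "tri T u w v = tri T u v w" "tri T v w u = tri T u v w"
    "tri T w u v = tri T u v w" "tri T w v u = tri T u v w"
    using tri_swap[OF assms] by metis+
  have 2: "tri T b a a = tri T a a b" "tri T a b a = tri T a a b" for a b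
    using tri_swap[OF assms] by metis+
  show ?thesis
    by (simp add: tri_add 1 2)
qed

text \<open>The value 0 on \<open>Y\<close> and \<open>Z\<close> is a mere default: only polynomials
  in \<open>X\<close> and \<open>U\<close> are evaluated at these points.\<close>

fun pt :: "complex^3 \<Rightarrow> complex^3 \<Rightarrow> indet \<Rightarrow> complex" where
  "pt x u (X i) = x $ i"
| "pt x u (U i) = u $ i"
| "pt x u (Y i) = 0"
| "pt x u (Z i) = 0"

lemma eval_lin: "eval (pt x u) (lin l) = ldot l x"
  by (simp add: lin_def ldot_def mult_ac)

lemma eval_cub: "eval (pt x u) (cub T) = tri T x x x"
  by (simp add: cub_expand tri_def mult_ac)

lemma eval_hmat: "eval (pt x u) (hmat T i j) = tri T (axis i 1) (axis j 1) x"
  by (simp add: hmat_def eval_lin tri_axis_12 ldot_def)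

text \<open>Polarization recovers the symmetric tensor from the values on the diagonal. Identities
  between cubic forms thus become computations with complex numbers.\<close>

lemma cubic_eqI:
  assumes "ternary_form 3 p" "ternary_form 3 q"
    and "\<And>x. eval (pt x 0) p = eval (pt x 0) q"
  shows "p = q"
proof -
  obtain S where S: "sym3 S" "p = cub S" using ternary_form_3_cub[OF assms(1)] .
  obtain T where T: "sym3 T" "q = cub T" using ternary_form_3_cub[OF assms(2)] .
  have d: "tri S x x x = tri T x x x" for x
    using assms(3)[of x] by (simp add: S T eval_cub)
  have "6 * tri S u v w = 6 * tri T u v w" for u v w
    unfolding polarization[OF S(1)] polarization[OF T(1)] d ..
  then have "S i j k = T i j k" for i j k
    by (metis tri_axis mult_cancel_left zero_neq_numeral)
  then have "S = T" by (intro ext)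
  then show ?thesis using S T by simp
qed

lemma ternary_form_lin: "ternary_form 1 (lin l)"
  using ternary_form_1_iff by blast

lemma ternary_form_cub: "ternary_form 3 (cub T)"
proof -
  have "ternary_form 2 (Var (X i) * lin l)" for i l
    using ternary_form_mult[OF ternary_form_Var ternary_form_lin, of i l] by (simp add: numeral_2_eq_2)
  then have "ternary_form 2 (quad Q)" for Q
    by (simp add: quad_def ternary_form_sum)
  from ternary_form_mult[OF ternary_form_Var this] have "ternary_form 3 (Var (X i) * quad Q)" for i Q
    by (simp add: eval_nat_numeral)
  then show ?thesis by (simp add: cub_def ternary_form_sum)
qed

lemma ternary_form_mult3:
  assumes "ternary_form 1 p" "ternary_form 1 q" "ternary_form 1 r"
  shows "ternary_form 3 (p * q * r)"
  using ternary_form_mult[OF ternary_form_mult[OF assms(1,2)] assms(3)] by (simp add: eval_nat_numeral)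

definition hdet :: "(3 \<Rightarrow> 3 \<Rightarrow> 3 \<Rightarrow> complex) \<Rightarrow> complex^3 \<Rightarrow> complex" where
  "hdet T x = det (\<chi> i j. tri T (axis i 1) (axis j 1) x)"

lemma eval_hessian:
  assumes "sym3 T"
  shows "eval (pt x u) (hessian (cub T)) = 108 * hdet T x"
  by (simp add: hessian_cub[OF assms] eval_hmat hdet_def det_3 power2_eq_square
      tri_swap(1)[OF assms, of "axis 2 1" "axis 1 1"] tri_swap(1)[OF assms, of "axis 3 1" "axis 1 1"]
      tri_swap(1)[OF assms, of "axis 3 1" "axis 2 1"] algebra_simps)

lemma ternary_form_hessian:
  assumes "ternary_form 3 f"
  shows "ternary_form 3 (hessian f)"
proof -
  obtain T where T: "sym3 T" "f = cub T" using ternary_form_3_cub[OF assms] .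
  have t: "ternary_form 3 (hmat T i j * hmat T k l * hmat T m n)" for i j k l m n
    unfolding hmat_def by (intro ternary_form_mult3 ternary_form_lin)
  have "hessian f = Const 108 * (hmat T 1 1 * hmat T 2 2 * hmat T 3 3
     + Const 2 * (hmat T 1 2 * hmat T 1 3 * hmat T 2 3)
     - hmat T 1 1 * hmat T 2 3 * hmat T 2 3 - hmat T 2 2 * hmat T 1 3 * hmat T 1 3
     - hmat T 3 3 * hmat T 1 2 * hmat T 1 2)"
    by (simp add: hessian_cub[OF T(1)] T(2) Const_numeral power2_eq_square mult.assoc)
  then show ?thesis
    by (auto intro!: ternary_form_Const_mult ternary_form_add ternary_form_diff t)
qed

definition cross :: "complex^3 \<Rightarrow> complex^3 \<Rightarrow> complex^3" where
  "cross u v = vector [u$2 * v$3 - u$3 * v$2, u$3 * v$1 - u$1 * v$3, u$1 * v$2 - u$2 * v$1]"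

text \<open>The adjugate of a symmetric matrix, taken at a cross product, is the Gram determinant of
  the two factors (Lagrange's identity).\<close>

lemma eval_theta:
  fixes x :: "complex^3"
  assumes "sym3 T"
  defines "B \<equiv> tri T x"
  shows "eval (pt x (cross u v)) (theta (cub T)) = 36 * (B u u * B v v - (B u v) ^ 2)"
proof -
  define m where "m i j = tri T (axis i 1) (axis j 1) x" for i j
  have m: "m 2 1 = m 1 2" "m 3 1 = m 1 3" "m 3 2 = m 2 3"
    using tri_swap(1)[OF assms(1)] by (auto simp: m_def)
  have "B v w = tri T v w x" for v w
    using tri_swap[OF assms(1)] unfolding B_def by metis
  then have B: "B v w = (\<Sum>i\<in>UNIV. \<Sum>j\<in>UNIV. m i j * v $ i * w $ j)" for v w
    unfolding m_def tri_axis_12 by (simp add: tri_nested sum_distrib_left mult_ac)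
  show ?thesis
    unfolding theta_cub[OF assms(1)] B sum_3
    by (simp add: eval_hmat m cross_def vector_3 flip: m_def) algebra
qed

lemma tri_axis_expand:
  assumes "sym3 T"
  shows "tri T u v w = (\<Sum>i\<in>UNIV. tri T u v (axis i 1) * w $ i)"
proof -
  have sw: "tri T u v w = tri T w u v" for w
    using tri_swap[OF assms] by metis
  have "tri T u v (axis i 1) = (\<Sum>j\<in>UNIV. (\<Sum>k\<in>UNIV. T i j k * v $ k) * u $ j)" for i
    unfolding sw[of "axis i 1"] by (simp only: tri_nested sum_axis mult_1_right)
  then show ?thesis
    unfolding sw[of w] by (simp only: tri_nested)
qed

lemma lin_zero [simp]: "lin 0 = 0"
  by (simp add: lin_def)

lemma lin_eq_0_iff: "lin l = 0 \<longleftrightarrow> l = 0"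
proof
  assume "lin l = 0"
  then have "ldot l x = 0" for x
    using eval_lin[of x 0 l] by simp
  then have "l $ i = 0" for i
    using ldot_axis[of l i 1] by simp
  then show "l = 0" by (simp add: vec_eq_iff)
qed simp

lemma ternary_form_lin_cube: "ternary_form 3 (lin l ^ 3)"
  using ternary_form_power[OF ternary_form_lin] by simp

text \<open>The minors at \<open>p\<close> and at \<open>q\<close> are two relations between
  T(p,p,p), T(p,p,q), T(p,q,q) and T(q,q,q). Eliminating T(p,q,q) expresses the cubic at
  \<open>q\<close> through the linear form T(p,p,.).\<close>

lemma cube_of_theta_zero:
  assumes "ternary_form 3 g" "theta g = 0" "g \<noteq> 0"
  obtains l where "g = lin l ^ 3" "l \<noteq> 0"
proof -
  obtain T where T: "sym3 T" "g = cub T" using ternary_form_3_cub[OF assms(1)] .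
  have key: "tri T p p p * tri T p q q = (tri T p p q) ^ 2" for p q
    using eval_theta[OF T(1), of p p q] assms(2) T(2) by simp
  have "\<exists>p. tri T p p p \<noteq> 0"
  proof (rule ccontr)
    assume "\<nexists>p. tri T p p p \<noteq> 0"
    then have "g = 0"
      by (intro cubic_eqI assms(1) ternary_form_zero) (simp add: T(2) eval_cub)
    then show False using assms(3) by simp
  qed
  then obtain p where p: "tri T p p p \<noteq> 0" ..
  define c where "c = tri T p p p"
  have sw: "tri T q q p = tri T p q q" "tri T q p p = tri T p p q" "tri T q p q = tri T p q q"
    "tri T p q p = tri T p p q" for q
    using tri_swap[OF T(1)] by metis+
  have *: "c ^ 2 * tri T q q q = (tri T p p q) ^ 3" for q
  proof (cases "tri T p p q = 0")
    case True
    have 0: "tri T p q q = 0" using key[of p q] True p by simp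
    \<comment> \<open>The minor at \<open>q\<close> reads 0 = 0 here. At \<open>q + p\<close> it
      becomes (T(q,q,q) + c) * c = c^2.\<close>
    let ?r = "q + p"
    have "tri T ?r ?r ?r * tri T ?r p p = (tri T ?r ?r p) ^ 2" by (rule key)
    then have "tri T q q q * c = 0"
      by (simp add: tri_add sw[of q] 0 True c_def power2_eq_square algebra_simps)
    then show ?thesis using True by auto
  next
    case False
    have "tri T q q q * tri T p p q = (tri T p q q) ^ 2"
      using key[of q p] by (simp add: sw[of q])
    moreover have "c * tri T p q q = (tri T p p q) ^ 2"
      using key[of p q] by (simp add: c_def)
    ultimately have "tri T p p q * (c ^ 2 * tri T q q q) = tri T p p q * (tri T p p q) ^ 3"
      by algebra
    then show ?thesis using False by simp
  qed
  \<comment> \<open>A cube root of 1/c^2 absorbs the constant, so that the cubic is itself a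
    cube.\<close>
  obtain r where r: "1 / c ^ 2 = r ^ 3" using exists_complex_root[of 3] by auto
  define l where "l = (\<chi> k. r * tri T p p (axis k 1))"
  have "ldot l x = r * tri T p p x" for x
    unfolding tri_axis_expand[OF T(1), of p p x] by (simp add: l_def ldot_def sum_distrib_left mult_ac)
  moreover have "tri T x x x = (r * tri T p p x) ^ 3" for x
  proof -
    have "r ^ 3 * c ^ 2 = 1" using r[symmetric] p by (simp add: c_def)
    then show ?thesis using *[of x] by algebra
  qed
  ultimately have "eval (pt x 0) g = eval (pt x 0) (lin l ^ 3)" for x
    by (simp add: T(2) eval_cub eval_lin)
  then have "g = lin l ^ 3"
    by (intro cubic_eqI assms(1) ternary_form_lin_cube)
  moreover from this have "l \<noteq> 0" using assms(3) by auto
  ultimately show ?thesis using that by blast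
qed

text \<open>The matrix \<open>hmat T\<close> of a cube is a multiple of the rank-one matrix of
  products of coefficients, so its minors of size 2 vanish.\<close>

lemma theta_lin_cube: "theta (lin l ^ 3) = 0"
proof -
  define T where "T i j k = l $ i * l $ j * l $ k" for i j k
  have T: "sym3 T" by (simp add: sym3_def T_def mult_ac)
  have "tri T x x x = ldot l x ^ 3" for x
    by (simp add: tri_nested T_def ldot_def power3_eq_cube sum_distrib_left sum_distrib_right mult_ac)
  then have "lin l ^ 3 = cub T"
    by (intro cubic_eqI ternary_form_lin_cube ternary_form_cub) (simp add: eval_lin eval_cub)
  moreover have "hmat T i j = Const (l $ i) * Const (l $ j) * lin l" for i j
  proof -
    have "hmat T i j = lin ((l $ i * l $ j) *s l)"
      unfolding hmat_def by (rule arg_cong[of _ _ lin]) (simp add: T_def vec_eq_iff)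
    then show ?thesis by (simp add: lin_scale Const_mult)
  qed
  ultimately show ?thesis
    by (simp add: theta_cub[OF T] power2_eq_square mult_ac)
qed

section \<open>Determinants, cross products and bases of three-space\<close>

definition det3 :: "complex^3 \<Rightarrow> complex^3 \<Rightarrow> complex^3 \<Rightarrow> complex" where
  "det3 u v w = ldot u (cross v w)"

lemma det3_expand:
  "det3 u v w = u$1 * (v$2 * w$3 - v$3 * w$2) + u$2 * (v$3 * w$1 - v$1 * w$3) + u$3 * (v$1 * w$2 - v$2 * w$1)"
  by (simp add: det3_def ldot_def sum_3 cross_def)

text \<open>Cramer's rule with the denominator cleared.\<close>

lemma cramer3:
  "det3 e p q *s v = det3 v p q *s e + det3 e v q *s p + det3 e p v *s q"
  by (simp add: vec_eq_iff forall_3 det3_expand algebra_simps)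

lemma det3_cross_axis:
  assumes "ldot a e = 1" "ldot a p = 0"
  shows "det3 e p (cross a b) = ldot p b"
proof -
  have "det3 e p (cross a b) = ldot a e * ldot p b - ldot a p * ldot e b"
    by (simp add: det3_expand ldot_def sum_3 cross_def) (simp add: algebra_simps)
  then show ?thesis using assms by simp
qed

lemma ldot_cross_self: "ldot a (cross a b) = 0"
  by (simp add: ldot_def sum_3 cross_def algebra_simps)

text \<open>A scaled axis serves as \<open>e\<close>, and \<open>cross a (axis k 1)\<close> as
  \<open>q\<close>, where \<open>p $ k\<close> is nonzero: the determinant is then exactly
  \<open>p $ k\<close>.\<close>

lemma extend_to_basis:
  assumes "a \<noteq> 0" "p \<noteq> 0" "ldot a p = 0"
  obtains e q where "ldot a e = 1" "ldot a q = 0" "det3 e p q \<noteq> 0"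
proof -
  obtain i where i: "a $ i \<noteq> 0" using assms(1) by (auto simp: vec_eq_iff)
  obtain k where k: "p $ k \<noteq> 0" using assms(2) by (auto simp: vec_eq_iff)
  have e: "ldot a (axis i (1 / a $ i)) = 1" using i by (simp add: ldot_axis)
  show ?thesis
    by (rule that[OF e ldot_cross_self[of a "axis k 1"]])
      (use k in \<open>simp add: det3_cross_axis[OF e assms(3)] ldot_axis\<close>)
qed

text \<open>Applying \<open>a\<close> to Cramer's expansion of \<open>w\<close> shows that the
  coefficient of \<open>e\<close> vanishes.\<close>

lemma in_span_of_kernel_basis:
  assumes "det3 e p q \<noteq> 0" "ldot a e = 1" "ldot a p = 0" "ldot a q = 0" "ldot a w = 0"
  obtains x y where "w = x *s p + y *s q"
proof -
  let ?D = "det3 e p q"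
  have "ldot a (?D *s w) = det3 w p q"
    unfolding cramer3[of e p q w] by (simp add: ldot_add ldot_scale assms)
  then have "det3 w p q = 0" using assms(5) by (simp add: ldot_scale)
  then have "?D *s w = det3 e w q *s p + det3 e p w *s q"
    using cramer3[of e p q w] by simp
  then have "(1 / ?D) *s (?D *s w) = (1 / ?D) *s (det3 e w q *s p + det3 e p w *s q)" by simp
  then have "w = (det3 e w q / ?D) *s p + (det3 e p w / ?D) *s q"
    using assms(1) by (simp add: vector_add_ldistrib)
  then show ?thesis by (rule that)
qed

lemma singular_matrix_kernel:
  fixes A :: "complex^3^3"
  shows "det A = 0 \<longleftrightarrow> (\<exists>v. v \<noteq> 0 \<and> A *v v = 0)"
  using invertible_det_nz[of A] invertible_left_inverse[of A] matrix_left_invertible_ker[of A] by auto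

text \<open>The condition on the right is symmetric in \<open>p\<close> and \<open>v\<close>, so a
  point where the Hessian vanishes can be traded for its kernel vector.\<close>

lemma hdet_eq_0_iff:
  assumes "sym3 T"
  shows "hdet T p = 0 \<longleftrightarrow> (\<exists>v. v \<noteq> 0 \<and> (\<forall>w. tri T p v w = 0))"
proof -
  let ?A = "\<chi> i j. tri T (axis i 1) (axis j 1) p"
  have A: "(?A *v v) $ i = tri T p v (axis i 1)" for v i
  proof -
    have 1: "tri T p v (axis i 1) = tri T (axis i 1) p v" "tri T (axis i 1) p w = tri T (axis i 1) w p" for w
      using tri_swap[OF assms] by metis+
    show ?thesis
      unfolding 1(1) tri_axis_expand[OF assms, of _ p v] by (simp add: matrix_vector_mult_def 1(2))
  qed
  have "tri T p v w = (\<Sum>i\<in>UNIV. tri T p v (axis i 1) * w $ i)" for v w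
    by (rule tri_axis_expand[OF assms])
  then have "?A *v v = 0 \<longleftrightarrow> (\<forall>w. tri T p v w = 0)" for v
    by (metis (no_types, lifting) A vec_eq_iff zero_index mult_zero_left sum.neutral)
  then show ?thesis unfolding hdet_def singular_matrix_kernel by simp
qed

subsection \<open>Cubics whose Hessian is a cube\<close>

lemma det3_add_mult: "det3 e (p + t *s v) v = det3 e p v"
  by (simp add: det3_expand algebra_simps)

lemma det3_scale_third: "det3 e p (x *s p + y *s q) = y * det3 e p q"
  by (simp add: det3_expand algebra_simps)

lemma det3_zero [simp]: "det3 e 0 v = 0"
  by (simp add: det3_expand)

text \<open>Let \<open>v\<close> be a kernel vector of \<open>p\<close> in the plane of zeros of
  \<open>a\<close>. If \<open>v\<close> is proportional to \<open>p\<close>, then \<open>p\<close>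
  works. Otherwise T(p,v,.) = 0, and the kernel vector of \<open>p + v\<close> yields a linear
  relation between T(p,p,.) and T(v,v,.), which makes some combination of \<open>p\<close> and
  \<open>v\<close> isotropic.\<close>

lemma isotropic_vector:
  assumes T: "sym3 T" and a: "a \<noteq> 0" and hess: "\<And>x. 108 * hdet T x = ldot a x ^ 3"
  obtains p where "p \<noteq> 0" "ldot a p = 0" "\<And>w. tri T p p w = 0"
proof -
  \<comment> \<open>By symmetry of \<open>T\<close>, the Hessian is also singular at a kernel vector \<open>v\<close>.\<close>
  have polar: "\<exists>v. v \<noteq> 0 \<and> ldot a v = 0 \<and> (\<forall>w. tri T p v w = 0)"
    if p: "p \<noteq> 0" "ldot a p = 0" for p
  proof -
    have "hdet T p = 0" using hess[of p] p(2) by simp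
    then obtain v where v: "v \<noteq> 0" "\<And>w. tri T p v w = 0"
      using hdet_eq_0_iff[OF T] by blast
    have "tri T v p w = 0" for w using v(2) tri_swap(1)[OF T] by metis
    then have "hdet T v = 0" using hdet_eq_0_iff[OF T] p(1) by blast
    then have "ldot a v = 0" using hess[of v] by simp
    then show ?thesis using v by blast
  qed
  have "\<exists>b. cross a b \<noteq> 0"
  proof (rule ccontr)
    assume "\<nexists>b. cross a b \<noteq> 0"
    then have "cross a (axis 1 1) = 0" "cross a (axis 2 1) = 0" by auto
    then have "a = 0" by (simp add: cross_def vec_eq_iff forall_3 axis_def)
    then show False using a by simp
  qed
  then obtain p where p: "p \<noteq> 0" "ldot a p = 0"
    using ldot_cross_self by blast
  obtain e q where eq: "ldot a e = 1" "ldot a q = 0" "det3 e p q \<noteq> 0"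
    using extend_to_basis[OF a p] .
  obtain v where v: "v \<noteq> 0" "ldot a v = 0" "\<And>w. tri T p v w = 0"
    using polar[OF p] by blast
  obtain x0 y0 where v_eq: "v = x0 *s p + y0 *s q"
    using in_span_of_kernel_basis[OF eq(3,1) p(2) eq(2) v(2)] .
  show ?thesis
  proof (cases "y0 = 0")
    case True
    then have "v = x0 *s p" "x0 \<noteq> 0" using v_eq v(1) by auto
    then have "tri T p p w = 0" for w using v(3)[of w] by (simp add: tri_scale)
    then show ?thesis using that p by blast
  next
    case False
    \<comment> \<open>So \<open>p\<close> and \<open>v\<close> span the plane of zeros of
      \<open>a\<close>.\<close>
    then have D: "det3 e p v \<noteq> 0" using eq(3) by (simp add: v_eq det3_scale_third)
    have nz: "p + t *s v \<noteq> 0" for t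
      using D det3_add_mult[of e p t v] by auto
    have "ldot a (p + 1 *s v) = 0" using p v by (simp add: ldot_add)
    then obtain w where w: "w \<noteq> 0" "ldot a w = 0" "\<And>z. tri T (p + 1 *s v) w z = 0"
      using polar[OF nz] by blast
    obtain x y where w_eq: "w = x *s p + y *s v"
      using in_span_of_kernel_basis[OF D eq(1) p(2) v(2) w(2)] .
    have pv: "tri T v p z = 0" for z using v(3) tri_swap(1)[OF T] by metis
    have rel: "x * tri T p p z + y * tri T v v z = 0" for z
      using w(3)[of z] by (simp add: w_eq tri_add tri_scale v(3) pv)
    show ?thesis
    proof (cases "x = 0")
      case True
      then have "y \<noteq> 0" using w_eq w(1) by auto
      then have "tri T v v z = 0" for z using rel[of z] True by simp
      then show ?thesis using that v by blast
    next
      case False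
      \<comment> \<open>The mixed terms vanish, so only t^2 matters; this value makes the relation
        \<open>rel\<close>, divided by \<open>x\<close>, the claim.\<close>
      obtain t where t: "y / x = t ^ 2" using exists_complex_root[of 2] by auto
      have "tri T (p + t *s v) (p + t *s v) z = 0" for z
      proof -
        have "tri T (p + t *s v) (p + t *s v) z = tri T p p z + t ^ 2 * tri T v v z"
          by (simp add: tri_add tri_scale v(3) pv power2_eq_square)
        also have "\<dots> = 0" using rel[of z] False by (simp add: field_simps flip: t)
        finally show ?thesis .
      qed
      moreover have "ldot a (p + t *s v) = 0" using p v by (simp add: ldot_add ldot_scale)
      ultimately show ?thesis using that nz by blast
    qed
  qed
qed

lemma tri_bilinear:
  "tri T u v z = (\<Sum>l\<in>UNIV. (\<Sum>k\<in>UNIV. u $ k * tri T (axis k 1) (axis l 1) z) * v $ l)"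
proof -
  have "tri T u v z = (\<Sum>l\<in>UNIV. \<Sum>k\<in>UNIV. \<Sum>m\<in>UNIV. T k l m * u $ k * v $ l * z $ m)"
    unfolding tri_def by (rule sum.swap)
  then show ?thesis
    unfolding tri_axis_12 by (simp add: sum_distrib_left mult_ac)
qed

lemma det_change_of_basis:
  fixes E :: "3 \<Rightarrow> complex^3"
  shows "det (\<chi> i j. tri T (E i) (E j) z) = (det3 (E 1) (E 2) (E 3)) ^ 2 * hdet T z"
proof -
  define P :: "complex^3^3" where "P = (\<chi> i. E i)"
  define A :: "complex^3^3" where "A = (\<chi> i j. tri T (axis i 1) (axis j 1) z)"
  have "(\<chi> i j. tri T (E i) (E j) z) = P ** A ** transpose P"
    unfolding tri_bilinear[of T "E _"]
    by (simp add: P_def A_def matrix_matrix_mult_def transpose_def vec_eq_iff)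
  moreover have "det P = det3 (E 1) (E 2) (E 3)"
    by (simp add: P_def det_3 det3_expand algebra_simps)
  ultimately show ?thesis
    by (simp add: det_mul det_transpose hdet_def A_def power2_eq_square mult_ac)
qed

text \<open>The left-hand side of \<open>eq\<close> is the determinant of $T(v,\cdot,\cdot)$ at $v = xe + yp + zq$ when $T(p,p,\cdot) = 0$.\<close>

lemma hessian_coefficients:
  fixes A b d k n g h c :: complex
  assumes eq: "\<And>x y z. 2 * (b*x + k*z) * (d*x + k*y + n*z) * (k*x + g*z)
      - (A*x + b*y + d*z) * (k*x + g*z)^2 - (n*x + g*y + h*z) * (b*x + k*z)^2 = c * x^3"
    and c: "c \<noteq> 0"
  shows "k = 0" "g = 0" "h = 0" "b \<noteq> 0" "n \<noteq> 0"
proof -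
  \<comment> \<open>Facts 1 to 4 compare the coefficients of z^3, y*z^2, x^3 and x*z^2, read off
    from values at small integer points.\<close>
  have 1: "2*k*g*n - d*g^2 - h*k^2 = 0"
    using eq[where x=0 and y=0 and z=1] by (simp add: algebra_simps power2_eq_square)
  have 2: "g * (k^2 - b*g) = 0"
    using eq[where x=0 and y=1 and z=1] 1 by (simp add: algebra_simps power2_eq_square)
  have 3: "2*b*d*k - A*k^2 - n*b^2 = c"
    using eq[where x=1 and y=0 and z=0] by (simp add: algebra_simps power2_eq_square)
  have 4: "2*(b*n*g + k*d*g + k*n*k) - A*g^2 - 2*d*k*g - n*k^2 - 2*h*b*k = 0"
    using eq[where x=1 and y=0 and z=1] eq[where x="-1" and y=0 and z=1] 3 by (simp add: algebra_simps power2_eq_square) algebra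
  show g: "g = 0"
  proof (rule ccontr)
    assume g: "g \<noteq> 0"
    then have "k^2 = b*g" using 2 by simp
    \<comment> \<open>Substitute k^2 = b*g in g^2 times the coefficient of x^3; by 1 and 4 all terms
      cancel.\<close>
    then have "g^2 * c = 0" using 1 3 4 by algebra
    then show False using c g by simp
  qed
  \<comment> \<open>Values at the four sign choices isolate the coefficient of x*y*z, which is 2*k^3
    once g = 0.\<close>
  show k: "k = 0"
    using eq[where x=1 and y=1 and z=1] eq[where x=1 and y=1 and z="-1"] eq[where x=1 and y="-1" and z=1] eq[where x=1 and y="-1" and z="-1"] g 1 by (simp add: algebra_simps power2_eq_square) algebra
  show b: "b \<noteq> 0" and n: "n \<noteq> 0" using 3 k c by auto
  have "b^2 * h = 0"
    using eq[where x=1 and y=0 and z=1] 3 g k by (simp add: algebra_simps power2_eq_square) algebra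
  then show "h = 0" using b by simp
qed

text \<open>In the basis \<open>e\<close>, \<open>p\<close>, \<open>q\<close> the Hessian
  determinant gains the factor \<open>(det3 e p q)^2\<close>, so \<open>hessian_coefficients\<close>
  applies with the nonzero constant \<open>(det3 e p q)^2 / 108\<close>.\<close>

lemma normal_form_coefficients:
  assumes T: "sym3 T" and hess: "\<And>x. 108 * hdet T x = ldot a x ^ 3"
    and basis: "det3 e p q \<noteq> 0" "ldot a e = 1" "ldot a p = 0" "ldot a q = 0"
    and iso: "\<And>w. tri T p p w = 0"
  shows "tri T e p q = 0" "tri T p q q = 0" "tri T q q q = 0" "tri T e e p \<noteq> 0" "tri T e q q \<noteq> 0"
proof -
  define E :: "3 \<Rightarrow> complex^3" where "E i = (if i = 1 then e else if i = 2 then p else q)" for i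
  have E: "E 1 = e" "E 2 = p" "E 3 = q" by (simp_all add: E_def)
  have s: "tri T p e w = tri T e p w" "tri T q e w = tri T e q w" "tri T q p w = tri T p q w" for w
    by (rule tri_swap(1)[OF T])+
  have s': "tri T e p e = tri T e e p" "tri T e q e = tri T e e q" "tri T e q p = tri T e p q"
    "tri T p q e = tri T e p q" "tri T q q e = tri T e q q" "tri T q q p = tri T p q q"
    "tri T p q p = 0" "tri T e p p = 0"
    using tri_swap[OF T] iso by metis+
  have "2 * (tri T e e p*x + tri T e p q*z) * (tri T e e q*x + tri T e p q*y + tri T e q q*z) * (tri T e p q*x + tri T p q q*z)
      - (tri T e e e*x + tri T e e p*y + tri T e e q*z) * (tri T e p q*x + tri T p q q*z)^2
      - (tri T e q q*x + tri T p q q*y + tri T q q q*z) * (tri T e e p*x + tri T e p q*z)^2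
      = (det3 e p q)^2 / 108 * x^3" for x y z
  proof -
    let ?v = "x *s e + y *s p + z *s q"
    have "ldot a ?v = x" by (simp add: ldot_add ldot_scale basis)
    then have "x^3 = 108 * hdet T ?v" by (simp only: hess)
    then have "(det3 e p q)^2 / 108 * x^3 = (det3 e p q)^2 * hdet T ?v" by simp
    also have "\<dots> = det (\<chi> i j. tri T (E i) (E j) ?v)"
      by (simp add: det_change_of_basis E)
    finally show ?thesis
      by (simp add: det_3 E tri_add tri_scale iso s s' power2_eq_square) (simp add: algebra_simps)
  qed
  note hessian_coefficients[OF this]
  then show "tri T e p q = 0" "tri T p q q = 0" "tri T q q q = 0" "tri T e e p \<noteq> 0" "tri T e q q \<noteq> 0"
    using basis(1) by simp_all
qed

lemma hdet_of_hessian: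
  assumes "sym3 T" "hessian (cub T) = lin l ^ 3"
  shows "108 * hdet T x = ldot l x ^ 3"
  using eval_hessian[OF assms(1), of x 0] by (simp add: assms(2) eval_lin)

lemma ternary_form_conic_tangent:
  assumes "ternary_form 1 a" "ternary_form 1 b" "ternary_form 1 c"
  shows "ternary_form 3 (a * (a * c + b ^ 2))"
  using ternary_form_add[OF ternary_form_mult3[OF assms(1,1,3)] ternary_form_mult3[OF assms(1,2,2)]]
  by (simp add: power2_eq_square algebra_simps)

text \<open>In coordinates x, y, z for the basis \<open>e\<close>, \<open>p\<close>,
  \<open>q\<close> only x^3, x^2*y, x^2*z and x*z^2 survive. The last gives x times a square, the
  others x^2 times a linear form. The latter involves y, hence the independence.\<close>

lemma conic_tangent_of_hessian:
  assumes "ternary_form 3 f" "hessian f = lin l ^ 3" "l \<noteq> 0"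
  shows "\<exists>a b c. ternary_form 1 a \<and> ternary_form 1 b \<and> ternary_form 1 c \<and>
    lin_indep3 a b c \<and> f = a * (a * c + b ^ 2)"
proof -
  obtain T where T: "sym3 T" "f = cub T" using ternary_form_3_cub[OF assms(1)] .
  have hess: "108 * hdet T x = ldot l x ^ 3" for x
    using hdet_of_hessian[OF T(1)] assms(2) T(2) by simp
  obtain p where p: "p \<noteq> 0" "ldot l p = 0" "\<And>w. tri T p p w = 0"
    using isotropic_vector[OF T(1) assms(3) hess] by blast
  obtain e q where b: "ldot l e = 1" "ldot l q = 0" "det3 e p q \<noteq> 0"
    using extend_to_basis[OF assms(3) p(1,2)] .
  note coeffs = normal_form_coefficients[OF T(1) hess b(3,1) p(2) b(2) p(3)]
  define D where "D = det3 e p q"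
  \<comment> \<open>The dual basis of \<open>e\<close>, \<open>p\<close>, \<open>q\<close>, by cross
    products.\<close>
  define x where "x = (1 / D) *s cross p q"
  define y where "y = (1 / D) *s cross q e"
  define z where "z = (1 / D) *s cross e p"
  have D: "D \<noteq> 0" using b(3) by (simp add: D_def)
  have coord: "ldot x v = det3 v p q / D" "ldot y v = det3 e v q / D" "ldot z v = det3 e p v / D" for v
    by (simp_all add: x_def y_def z_def ldot_scale)
      (simp_all add: ldot_def sum_3 cross_def det3_expand algebra_simps)
  have v: "v = ldot x v *s e + ldot y v *s p + ldot z v *s q" for v
  proof -
    have "(1 / D) *s (D *s v) = (1 / D) *s (det3 v p q *s e + det3 e v q *s p + det3 e p v *s q)"
      unfolding D_def cramer3[of e p q v] ..
    then show ?thesis using D by (simp add: coord vector_add_ldistrib)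
  qed
  have dual: "ldot x e = 1" "ldot x p = 0" "ldot x q = 0" "ldot y e = 0" "ldot y p = 1" "ldot y q = 0"
    "ldot z e = 0" "ldot z p = 0" "ldot z q = 1"
    using D by (simp_all add: coord flip: D_def) (simp_all add: det3_expand algebra_simps)
  obtain s where s: "3 * tri T e q q = s ^ 2" using exists_complex_root[of 2] by auto
  have s0: "s \<noteq> 0" using coeffs(5) s by auto
  define w where "w = tri T e e e *s x + (3 * tri T e e p) *s y + (3 * tri T e e q) *s z"
  let ?a = "lin x" and ?b = "lin (s *s z)" and ?c = "lin w"
  have "lin_indep3 ?a ?b ?c"
    unfolding lin_indep3_def
  proof (intro allI impI)
    fix r1 r2 r3 assume "Const r1 * ?a + Const r2 * ?b + Const r3 * ?c = 0"
    then have *: "r1 * ldot x v + r2 * (s * ldot z v) + r3 * ldot w v = 0" for v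
      using eval_lin[of v 0] by (metis eval_add eval_mult eval_Const eval_zero ldot_scale(2))
    have "r3 = 0" using *[of p] coeffs(4) by (simp add: dual w_def ldot_add ldot_scale)
    moreover from this have "r2 = 0" using *[of q] s0 by (simp add: dual)
    moreover from calculation have "r1 = 0" using *[of e] by (simp add: dual)
    ultimately show "r1 = 0 \<and> r2 = 0 \<and> r3 = 0" by simp
  qed
  moreover have "f = ?a * (?a * ?c + ?b ^ 2)"
  proof (intro cubic_eqI assms(1) ternary_form_conic_tangent ternary_form_lin)
    fix v
    have sw: "tri T p e w = tri T e p w" "tri T q e w = tri T e q w" "tri T q p w = tri T p q w" for w
      by (rule tri_swap(1)[OF T(1)])+
    have sw': "tri T e p e = tri T e e p" "tri T e q e = tri T e e q" "tri T e q p = tri T e p q"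
      "tri T p q e = tri T e p q" "tri T q q e = tri T e q q" "tri T q q p = tri T p q q"
      "tri T p q p = 0" "tri T e p p = 0"
      using tri_swap[OF T(1)] p(3) by metis+
    have expand: "tri T u u u = tri T e e e * X^3 + 3 * tri T e e p * X^2 * Y + 3 * tri T e e q * X^2 * Z
        + 3 * tri T e q q * X * Z^2" if "u = X *s e + Y *s p + Z *s q" for u X Y Z
      unfolding that
      by (simp add: tri_add tri_scale p(3) sw sw' coeffs power2_eq_square power3_eq_cube)
        (simp add: algebra_simps)
    show "eval (pt v 0) f = eval (pt v 0) (?a * (?a * ?c + ?b ^ 2))"
      using expand[OF v[of v]]
      by (simp add: T(2) eval_cub eval_lin w_def ldot_add ldot_scale s power2_eq_square power3_eq_cube
          algebra_simps)
  qed
  ultimately show ?thesis using ternary_form_lin by blast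
qed

section \<open>The Hessian of a conic with a tangent line\<close>

lemma det3_eq_0_dependent:
  assumes "det3 u v w = 0"
  obtains r s t where "r *s u + s *s v + t *s w = 0" "r \<noteq> 0 \<or> s \<noteq> 0 \<or> t \<noteq> 0"
proof -
  define A :: "complex^3^3" where "A = (\<chi> i j. vector [u $ i, v $ i, w $ i] $ j)"
  have "det A = 0" using assms by (simp add: A_def det_3 det3_expand algebra_simps)
  then obtain c where c: "c \<noteq> 0" "A *v c = 0" using singular_matrix_kernel by blast
  have "(c$1) *s u + (c$2) *s v + (c$3) *s w = 0"
    using c(2) by (simp add: A_def matrix_vector_mult_def vec_eq_iff sum_3 mult_ac)
  moreover have "c$1 \<noteq> 0 \<or> c$2 \<noteq> 0 \<or> c$3 \<noteq> 0" using c(1) by (auto simp: vec_eq_iff forall_3)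
  ultimately show ?thesis using that by blast
qed

lemma hessian_of_conic_tangent:
  assumes "lin_indep3 (lin a) (lin b) (lin c)"
  obtains l where "l \<noteq> 0" "hessian (lin a * (lin a * lin c + lin b ^ 2)) = lin l ^ 3"
proof -
  \<comment> \<open>The symmetrization of the tensors of a*a*c and a*b*b.\<close>
  define S where "S i j k = (a$i * a$j * c$k + a$i * c$j * a$k + c$i * a$j * a$k
      + a$i * b$j * b$k + b$i * a$j * b$k + b$i * b$j * a$k) / 3" for i j k
  have S: "sym3 S" by (simp add: sym3_def S_def algebra_simps)
  have m: "tri S (axis i 1) (axis j 1) x = (ldot c x * a$i * a$j + ldot a x * (a$i * c$j + c$i * a$j)
      + ldot b x * (a$i * b$j + b$i * a$j) + ldot a x * b$i * b$j) / 3" for i j x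
    by (simp add: tri_axis_12 S_def ldot_def sum_3 field_simps)
  let ?f = "lin a * (lin a * lin c + lin b ^ 2)"
  have f: "ternary_form 3 ?f"
    by (intro ternary_form_conic_tangent ternary_form_lin)
  have "?f = cub S"
  proof (intro cubic_eqI f ternary_form_cub)
    fix x
    have "tri S x x x = (\<Sum>l\<in>UNIV. (\<Sum>k\<in>UNIV. x $ k * tri S (axis k 1) (axis l 1) x) * x $ l)"
      by (rule tri_bilinear)
    also have "\<dots> = (ldot c x * ldot a x * ldot a x + 2 * ldot a x * ldot a x * ldot c x
        + 2 * ldot b x * ldot a x * ldot b x + ldot a x * ldot b x * ldot b x) / 3"
      unfolding m by (simp add: ldot_def sum_3) (simp add: field_simps)
    also have "\<dots> = ldot a x * (ldot a x * ldot c x + ldot b x ^ 2)"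
      by (simp add: power2_eq_square algebra_simps)
    finally show "eval (pt x 0) ?f = eval (pt x 0) (cub S)"
      by (simp add: eval_cub eval_lin)
  qed
  define D where "D = det3 a b c"
  have D: "D \<noteq> 0"
  proof
    assume "D = 0"
    then obtain r s t where rst: "r *s a + s *s b + t *s c = 0" "r \<noteq> 0 \<or> s \<noteq> 0 \<or> t \<noteq> 0"
      using det3_eq_0_dependent unfolding D_def by blast
    have "Const r * lin a + Const s * lin b + Const t * lin c = lin (r *s a + s *s b + t *s c)"
      by (simp add: lin_add lin_scale)
    then show False using rst assms by (simp add: lin_indep3_def)
  qed
  have hd: "hdet S x = - (D ^ 2 * ldot a x ^ 3) / 27" for x
  proof -
    define M :: "complex^3^3" where "M = (\<chi> i. vector [a, b, c] $ i)"
    \<comment> \<open>The matrix of S(.,.,x) in the coordinates a, b, c. It is triangular along the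
      antidiagonal, so its determinant is a cube.\<close>
    define H :: "complex^3^3" where "H = (\<chi> i. vector
      [vector [ldot c x / 3, ldot b x / 3, ldot a x / 3], vector [ldot b x / 3, ldot a x / 3, 0],
       vector [ldot a x / 3, 0, 0]] $ i)"
    have "(\<chi> i j. tri S (axis i 1) (axis j 1) x) = transpose M ** H ** M"
      by (simp add: m M_def H_def matrix_matrix_mult_def transpose_def vec_eq_iff sum_3 field_simps)
    moreover have "det M = D" by (simp add: M_def D_def det_3 det3_expand algebra_simps)
    moreover have "det H = - (ldot a x ^ 3) / 27" by (simp add: H_def det_3 power3_eq_cube)
    ultimately show ?thesis
      by (simp add: hdet_def det_mul det_transpose power2_eq_square)
  qed
  \<comment> \<open>The constant is 108 * (- D^2 / 27).\<close>
  obtain k where k: "- 4 * D ^ 2 = k ^ 3" using exists_complex_root[of 3] by auto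
  have "hessian ?f = lin (k *s a) ^ 3"
  proof (intro cubic_eqI ternary_form_hessian f ternary_form_lin_cube)
    fix x
    show "eval (pt x 0) (hessian ?f) = eval (pt x 0) (lin (k *s a) ^ 3)"
      unfolding \<open>?f = cub S\<close> eval_hessian[OF S] hd
      by (simp add: eval_lin ldot_scale power_mult_distrib flip: k)
  qed
  moreover have "k *s a \<noteq> 0"
  proof -
    have "a \<noteq> 0" using D by (auto simp: D_def det3_expand)
    moreover have "k \<noteq> 0" using k D by auto
    ultimately show ?thesis by simp
  qed
  ultimately show ?thesis using that by blast
qed

subsection \<open>Waring rank\<close>

lemma common_zero:
  obtains v where "v \<noteq> 0" "ldot u v = 0" "ldot w v = 0"
proof -
  define A :: "complex^3^3" where "A = (\<chi> i. vector [u, w, w] $ i)"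
  have "det A = 0" by (simp add: A_def det_3)
  then obtain v where v: "v \<noteq> 0" "A *v v = 0" using singular_matrix_kernel by blast
  then have "(A *v v) $ 1 = 0" "(A *v v) $ 2 = 0" by simp_all
  then have "ldot u v = 0" "ldot w v = 0"
    by (simp_all add: A_def matrix_vector_mult_def ldot_def)
  then show ?thesis using that v(1) by blast
qed

lemma four_cubes_hessian_not_cube:
  fixes L :: "nat \<Rightarrow> complex^3"
  assumes "hessian (\<Sum>n<4. lin (L n) ^ 3) = lin a ^ 3"
  shows "a = 0"
proof (rule ccontr)
  assume a: "a \<noteq> 0"
  define S where "S i j k = (\<Sum>n<4. L n $ i * L n $ j * L n $ k)" for i j k
  have S: "sym3 S" by (simp add: sym3_def S_def mult_ac)
  have tri_S: "tri S x y z = (\<Sum>n<4. ldot (L n) x * ldot (L n) y * ldot (L n) z)" for x y z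
  proof -
    have "(\<Sum>k\<in>UNIV. S i j k * z $ k) = (\<Sum>n<4. L n $ i * L n $ j * ldot (L n) z)" for i j
      unfolding S_def ldot_def sum_distrib_left sum_distrib_right
      by (subst sum.swap) (simp add: mult_ac)
    moreover have "(\<Sum>j\<in>UNIV. (\<Sum>n<4. L n $ i * L n $ j * ldot (L n) z) * y $ j)
        = (\<Sum>n<4. L n $ i * ldot (L n) y * ldot (L n) z)" for i
      unfolding ldot_def[of _ y] sum_distrib_left sum_distrib_right
      by (subst sum.swap) (simp add: mult_ac)
    moreover have "(\<Sum>i\<in>UNIV. (\<Sum>n<4. L n $ i * ldot (L n) y * ldot (L n) z) * x $ i)
        = (\<Sum>n<4. ldot (L n) x * ldot (L n) y * ldot (L n) z)"
      unfolding ldot_def[of _ x] sum_distrib_left sum_distrib_right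
      by (subst sum.swap) (simp add: mult_ac)
    ultimately show ?thesis by (simp only: tri_nested)
  qed
  have "(\<Sum>n<4. lin (L n) ^ 3) = cub S"
    by (intro cubic_eqI ternary_form_sum ternary_form_lin_cube ternary_form_cub)
      (simp add: eval_lin eval_cub tri_S power3_eq_cube)
  then have hess: "108 * hdet S x = ldot a x ^ 3" for x
    using hdet_of_hessian[OF S] assms by simp
  have indep: "det3 a (L i) (L j) = 0" if ij: "i < 4" "j < 4" for i j
  proof (cases "i = j")
    case True
    then show ?thesis by (simp add: det3_expand)
  next
    case False
    \<comment> \<open>The two remaining indices.\<close>
    obtain k l where kl: "\<And>n. n < 4 \<Longrightarrow> n \<in> {i, j, k, l}"
    proof -
      have "card ({..<4} - {i, j}) = 2"
        using ij False by (simp add: card_Diff_subset)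
      then obtain k l where "{..<4} - {i, j} = {k, l}"
        by (auto simp: card_2_iff)
      then show ?thesis by (intro that[of k l]) blast
    qed
    let ?x = "cross (L i) (L j)"
    obtain v where v: "v \<noteq> 0" "ldot (L k) v = 0" "ldot (L l) v = 0" by (rule common_zero)
    have x: "ldot (L i) ?x = 0" "ldot (L j) ?x = 0"
      by (simp_all add: ldot_def cross_def sum_3 algebra_simps)
    \<comment> \<open>Two of the linear forms vanish at \<open>?x\<close> and the other two at
      \<open>v\<close>, so \<open>v\<close> is a kernel vector at \<open>?x\<close> and the Hessian
      vanishes there.\<close>
    have "ldot (L n) ?x * ldot (L n) v = 0" if "n < 4" for n
      using kl[OF that] v x by auto
    then have "tri S ?x v w = 0" for w
      unfolding tri_S by (intro sum.neutral) simp
    then have "hdet S ?x = 0" using hdet_eq_0_iff[OF S] v(1) by blast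
    then show ?thesis using hess[of ?x] by (simp add: det3_def)
  qed
  \<comment> \<open>If some \<open>cross a (L i)\<close> is nonzero, it is a common zero. Otherwise
    every \<open>L n\<close> is a multiple of \<open>a\<close>, and any zero of \<open>a\<close>
    will do.\<close>
  obtain y where y: "y \<noteq> 0" "\<And>n. n < 4 \<Longrightarrow> ldot (L n) y = 0"
  proof (cases "\<exists>i<4. cross a (L i) \<noteq> 0")
    case True
    then obtain i where i: "i < 4" "cross a (L i) \<noteq> 0" by blast
    have "ldot (L n) (cross a (L i)) = 0" if "n < 4" for n
    proof -
      have "ldot (L n) (cross a (L i)) = - det3 a (L n) (L i)"
        by (simp add: det3_expand ldot_def cross_def sum_3 algebra_simps)
      then show ?thesis using indep[OF that i(1)] by simp
    qed
    then show ?thesis using that i by blast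
  next
    case False
    obtain y where y: "y \<noteq> 0" "ldot a y = 0" using common_zero[of a a] by blast
    obtain k where k: "a $ k \<noteq> 0" using a by (auto simp: vec_eq_iff)
    have "ldot (L n) y = 0" if "n < 4" for n
    proof -
      have "a $ i * L n $ j = a $ j * L n $ i" for i j
        using False that exhaust_3[of i] exhaust_3[of j]
        by (auto simp: cross_def vec_eq_iff forall_3)
      then have "a $ k * ldot (L n) y = L n $ k * ldot a y"
        by (simp add: ldot_def sum_distrib_left flip: mult.assoc) (simp add: mult_ac)
      then show ?thesis using k y by simp
    qed
    then show ?thesis using that y by blast
  qed
  \<comment> \<open>A common zero is a kernel vector at every point, so the Hessian vanishes
    identically.\<close>
  then have "tri S x y w = 0" for x w
    by (simp add: tri_S)
  then have "hdet S x = 0" for x using hdet_eq_0_iff[OF S] y(1) by blast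
  then have "ldot a x = 0" for x using hess[of x] by simp
  then have "a $ i = 0" for i using ldot_axis[of a i 1] by simp
  then show False using a by (simp add: vec_eq_iff)
qed

text \<open>Twelve times the form is
  \<open>(a+b+c)^3 + (a-b+c)^3 - (a+ib-c)^3 - (a-ib-c)^3 - 4*c^3\<close>; the cube roots
  \<open>r\<close> and \<open>s\<close> absorb 1/12 and 4/12.\<close>

lemma conic_tangent_sum_of_5_cubes:
  assumes abc: "ternary_form 1 a" "ternary_form 1 b" "ternary_form 1 c"
  obtains l :: "nat \<Rightarrow> cpoly"
    where "\<And>i. ternary_form 1 (l i)" "a * (a * c + b ^ 2) = (\<Sum>i<5. l i ^ 3)"
proof -
  obtain r :: complex where r: "1 / 12 = r ^ 3"
    by (metis exists_complex_root zero_neq_numeral)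
  obtain s :: complex where s: "1 / 3 = s ^ 3"
    by (metis exists_complex_root zero_neq_numeral)
  define l where "l i = (if i = 0 then Const r * (a + b + c)
    else if i = 1 then Const r * (a - b + c)
    else if i = 2 then Const (- r) * (a + Const \<i> * b - c)
    else if i = 3 then Const (- r) * (a - Const \<i> * b - c)
    else Const (- s) * c)" for i :: nat
  have l: "ternary_form 1 (l i)" for i
    unfolding l_def using abc
    by (auto intro!: ternary_form_Const_mult ternary_form_add ternary_form_diff)
  have "a * (a * c + b ^ 2) = (\<Sum>i<5. l i ^ 3)"
  proof (intro cubic_eqI ternary_form_conic_tangent abc ternary_form_sum)
    show "ternary_form 3 (l i ^ 3)" for i using ternary_form_power[OF l, of 3] .
    fix x
    have "A * (A * C + B\<^sup>2) = (r * (A + B + C)) ^ 3 + (r * (A - B + C)) ^ 3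
        + (- (r * (A + \<i> * B - C))) ^ 3 + (- (r * (A - \<i> * B - C))) ^ 3 + (- (s * C)) ^ 3"
      for A B C
    proof -
      have i: "\<i> ^ 2 = -1" by simp
      have r: "12 * r ^ 3 = 1" by (simp flip: r)
      have s: "3 * s ^ 3 = 1" by (simp flip: s)
      show ?thesis using i r s by algebra
    qed
    then show "eval (pt x 0) (a * (a * c + b ^ 2)) = eval (pt x 0) (\<Sum>i<5. l i ^ 3)"
      by (simp add: l_def eval_nat_numeral)
  qed
  then show ?thesis using that l by blast
qed

lemma waring_rank_eq_5:
  assumes "ternary_form 1 a" "ternary_form 1 b" "ternary_form 1 c"
    and f: "f = a * (a * c + b ^ 2)" and hess: "hessian f = lin l ^ 3" "l \<noteq> 0"
  shows "waring_rank 3 f = 5"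
  unfolding waring_rank_def
proof (rule Least_equality)
  obtain m :: "nat \<Rightarrow> cpoly"
    where m: "\<And>i. ternary_form 1 (m i)" "a * (a * c + b ^ 2) = (\<Sum>i<5. m i ^ 3)"
    using conic_tangent_sum_of_5_cubes[OF assms(1-3)] by blast
  show "\<exists>l :: nat \<Rightarrow> cpoly. (\<forall>i<5. ternary_form 1 (l i)) \<and> f = (\<Sum>i<5. l i ^ 3)"
    unfolding f using m by (intro exI[of _ m] conjI allI impI)
next
  fix r assume "\<exists>l :: nat \<Rightarrow> cpoly. (\<forall>i<r. ternary_form 1 (l i)) \<and> f = (\<Sum>i<r. l i ^ 3)"
  then obtain m where m: "\<And>i. i < r \<Longrightarrow> ternary_form 1 (m i)" "f = (\<Sum>i<r. m i ^ 3)" by blast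
  show "5 \<le> r"
  proof (rule ccontr)
    assume "\<not> 5 \<le> r"
    then have r: "r \<le> 4" by simp
    \<comment> \<open>Shorter sums are padded with zero forms to exactly four cubes.\<close>
    define m' where "m' i = (if i < r then m i else 0)" for i
    have "\<forall>i. \<exists>L. m' i = lin L"
      using m(1) by (auto simp: m'_def simp flip: ternary_form_1_iff simp del: One_nat_def)
    then obtain L where L: "\<And>i. m' i = lin (L i)" by metis
    have "f = (\<Sum>i<r. m' i ^ 3)" by (simp add: m(2) m'_def)
    also have "\<dots> = (\<Sum>i<4. m' i ^ 3)"
      using r by (intro sum.mono_neutral_left) (auto simp: m'_def)
    finally have "f = (\<Sum>i<4. lin (L i) ^ 3)" by (simp add: L)
    then have "l = 0" using hess(1) by (intro four_cubes_hessian_not_cube) simp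
    then show False using hess(2) by simp
  qed
qed

theorem lemma5p13:
  fixes f :: cpoly
  assumes "ternary_form 3 f"
  defines "P1 \<equiv> theta (hessian f) = 0 \<and> hessian f \<noteq> 0"
    and "P2 \<equiv> (\<exists>a. ternary_form 1 a \<and> a \<noteq> 0 \<and> hessian f = a ^ 3)"
    and "P3 \<equiv> (\<exists>a b c. ternary_form 1 a \<and> ternary_form 1 b \<and> ternary_form 1 c \<and>
                 lin_indep3 a b c \<and> f = a * (a * c + b ^ 2))"
  shows "(P1 \<longleftrightarrow> P2) \<and> (P2 \<longleftrightarrow> P3) \<and> (P1 \<longrightarrow> waring_rank 3 f = 5)"
proof -
  have P2_iff: "P2 \<longleftrightarrow> (\<exists>l. l \<noteq> 0 \<and> hessian f = lin l ^ 3)"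
    unfolding P2_def ternary_form_1_iff using lin_eq_0_iff by blast
  have "P1 \<longrightarrow> P2"
    unfolding P1_def P2_iff
    by (blast elim: cube_of_theta_zero[OF ternary_form_hessian[OF assms(1)]])
  moreover have "P2 \<longrightarrow> P1"
  proof
    assume P2
    then obtain l where l: "l \<noteq> 0" "hessian f = lin l ^ 3" unfolding P2_iff by blast
    have "hessian f \<noteq> 0"
    proof
      assume "hessian f = 0"
      then have "ldot l x ^ 3 = 0" for x
        using l(2) eval_lin[of x 0 l] by (metis eval_power eval_zero)
      then have "l $ i = 0" for i using ldot_axis[of l i 1] by simp
      then show False using l(1) by (simp add: vec_eq_iff)
    qed
    then show P1 using l theta_lin_cube by (simp add: P1_def)
  qed
  moreover have "P2 \<longrightarrow> P3"
    unfolding P2_iff P3_def using conic_tangent_of_hessian[OF assms(1)] by blast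
  moreover have "P3 \<longrightarrow> P2"
    unfolding P2_iff P3_def ternary_form_1_iff
    by (auto elim!: hessian_of_conic_tangent)
  \<comment> \<open>The explicit form in \<open>P3\<close> gives the upper bound, the cube in
    \<open>P2\<close> the lower one.\<close>
  moreover have "P2 \<and> P3 \<longrightarrow> waring_rank 3 f = 5"
    unfolding P2_iff P3_def using waring_rank_eq_5 by blast
  ultimately show ?thesis by blast
qed

end
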